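(* Let $d\ge1$. Every $d(d+1)$-connected graph is $\left(\binom{d+1}{2}+1\right)$-redundantly rigid and $\binom{d+1}{2}$-redundantly globally rigid in $\mathbb{R}^d$.
   Context: A graph is rigid (resp. globally rigid) in $\mathbb{R}^d$ if some (equivalently every) generic framework $(G,p)$ in $\mathbb{R}^d$ (coordinates algebraically independent over $\mathbb{Q}$) is rigid (resp. globally rigid): $(G,p)$ is rigid if there is $\varepsilon>0$ such that every $(G,q)$ with the same edge lengths and $\|p(v)-q(v)\|<\varepsilon$ for all $v$ has all pairwise distances equal to those of $(G,p)$; it is globally rigid if every $(G,q)$ with the same edge lengths has all pairwise distances equal to those of $(G,p)$. A graph $G$ is $t$-redundantly (globally) rigid in $\mathbb{R}^d$ if for every $E_0\subseteq E(G)$ with $|E_0|<t$, $G-E_0$ is (globally) rigid in $\mathbb{R}^d$. *)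

theory Defs
  imports "HOL-Analysis.Analysis" "HOL-Library.Poly_Mapping"
begin

definition simple_graph :: "'a set \<Rightarrow> 'a set set \<Rightarrow> bool" where
  "simple_graph V E \<longleftrightarrow> finite V \<and> (\<forall>e\<in>E. e \<subseteq> V \<and> card e = 2)"

definition connected_graph :: "'a set \<Rightarrow> 'a set set \<Rightarrow> bool" where
  "connected_graph V E \<longleftrightarrow>
     V \<noteq> {} \<and> (\<forall>u\<in>V. \<forall>v\<in>V. (u, v) \<in> {(x, y). {x, y} \<in> E}\<^sup>*)"

definition k_connected :: "nat \<Rightarrow> 'a set \<Rightarrow> 'a set set \<Rightarrow> bool" where
  "k_connected k V E \<longleftrightarrow>
     card V > k \<and>
     (\<forall>S\<subseteq>V. card S < k \<longrightarrow> connected_graph (V - S) {e \<in> E. e \<inter> S = {}})"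

text \<open>A multivariate polynomial over the rationals with variables in \<open>'i\<close> is a finitely
  supported map from monomials (finitely supported exponent maps) to coefficients.\<close>

definition eval_rat_poly :: "(('i \<Rightarrow>\<^sub>0 nat) \<Rightarrow>\<^sub>0 rat) \<Rightarrow> ('i \<Rightarrow> real) \<Rightarrow> real" where
  "eval_rat_poly P c =
     (\<Sum>m\<in>Poly_Mapping.keys P. of_rat (Poly_Mapping.lookup P m) * (\<Prod>i\<in>Poly_Mapping.keys m. c i ^ Poly_Mapping.lookup m i))"

definition alg_independent_over_rat :: "'i set \<Rightarrow> ('i \<Rightarrow> real) \<Rightarrow> bool" where
  "alg_independent_over_rat I c \<longleftrightarrow>
     (\<forall>P. (\<forall>m\<in>Poly_Mapping.keys P. Poly_Mapping.keys m \<subseteq> I) \<longrightarrow> eval_rat_poly P c = 0 \<longrightarrow> P = 0)"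

text \<open>A framework is given by a placement \<open>p :: 'a \<Rightarrow> real ^ 'd\<close>; only its values on the vertex
  set matter. The dimension of the ambient space is \<open>CARD('d)\<close>.\<close>

definition generic_placement :: "'a set \<Rightarrow> ('a \<Rightarrow> real ^ 'd::finite) \<Rightarrow> bool" where
  "generic_placement V p \<longleftrightarrow> alg_independent_over_rat (V \<times> UNIV) (\<lambda>(v, i). p v $ i)"

definition same_edge_lengths ::
    "'a set set \<Rightarrow> ('a \<Rightarrow> real ^ 'd::finite) \<Rightarrow> ('a \<Rightarrow> real ^ 'd) \<Rightarrow> bool" where
  "same_edge_lengths E p q \<longleftrightarrow>
     (\<forall>u v. {u, v} \<in> E \<longrightarrow> dist (p u) (p v) = dist (q u) (q v))"

definition same_distances ::
    "'a set \<Rightarrow> ('a \<Rightarrow> real ^ 'd::finite) \<Rightarrow> ('a \<Rightarrow> real ^ 'd) \<Rightarrow> bool" where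
  "same_distances V p q \<longleftrightarrow>
     (\<forall>u\<in>V. \<forall>v\<in>V. dist (p u) (p v) = dist (q u) (q v))"

definition rigid_framework ::
    "'a set \<Rightarrow> 'a set set \<Rightarrow> ('a \<Rightarrow> real ^ 'd::finite) \<Rightarrow> bool" where
  "rigid_framework V E p \<longleftrightarrow>
     (\<exists>\<epsilon>>0. \<forall>q. same_edge_lengths E p q \<and> (\<forall>v\<in>V. norm (p v - q v) < \<epsilon>)
        \<longrightarrow> same_distances V p q)"

definition globally_rigid_framework ::
    "'a set \<Rightarrow> 'a set set \<Rightarrow> ('a \<Rightarrow> real ^ 'd::finite) \<Rightarrow> bool" where
  "globally_rigid_framework V E p \<longleftrightarrow>
     (\<forall>q. same_edge_lengths E p q \<longrightarrow> same_distances V p q)"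

definition rigid_graph :: "'d::finite itself \<Rightarrow> 'a set \<Rightarrow> 'a set set \<Rightarrow> bool" where
  "rigid_graph _ V E \<longleftrightarrow>
     (\<exists>p :: 'a \<Rightarrow> real ^ 'd. generic_placement V p \<and> rigid_framework V E p)"

definition globally_rigid_graph :: "'d::finite itself \<Rightarrow> 'a set \<Rightarrow> 'a set set \<Rightarrow> bool" where
  "globally_rigid_graph _ V E \<longleftrightarrow>
     (\<exists>p :: 'a \<Rightarrow> real ^ 'd. generic_placement V p \<and> globally_rigid_framework V E p)"

definition redundantly_rigid ::
    "'d::finite itself \<Rightarrow> nat \<Rightarrow> 'a set \<Rightarrow> 'a set set \<Rightarrow> bool" where
  "redundantly_rigid D t V E \<longleftrightarrow>
     (\<forall>E0\<subseteq>E. card E0 < t \<longrightarrow> rigid_graph D V (E - E0))"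

definition redundantly_globally_rigid ::
    "'d::finite itself \<Rightarrow> nat \<Rightarrow> 'a set \<Rightarrow> 'a set set \<Rightarrow> bool" where
  "redundantly_globally_rigid D t V E \<longleftrightarrow>
     (\<forall>E0\<subseteq>E. card E0 < t \<longrightarrow> globally_rigid_graph D V (E - E0))"

end

theory Submission
  imports Defs "HOL-Computational_Algebra.Polynomial" "HOL-Library.Function_Algebras"
begin

text \<open>
  Fix a generic placement \<open>p\<close> and let \<open>J\<close> be either the closure of the remaining graph in the rigidity
  matroid or the set of its globally linked pairs. In both cases \<open>J\<close> is closed under the following rule:
  if \<open>W\<close> consists of at least \<open>d + 1\<close> neighbours of \<open>v\<close>, and all pairs in \<open>W\<close> lie in the matroid closure of
  \<open>J - v\<close>, then \<open>W\<close> is a clique of \<open>J\<close>. For globally linked pairs this is proved by applying derivations of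
  the field of reals to the equations \<open>|p x - p y| = |q x - q y|\<close>: as \<open>p\<close> is generic, its points may be given
  arbitrary velocities, which takes the place of Sard's theorem.

  Now add the vertices in random order (an idea of Villanyi). A vertex with \<open>a\<close> predecessors among its
  neighbours increases the rank by at least \<open>min d a\<close>, and by \<open>d + 1\<close> if \<open>a > d\<close> and these
  predecessors are not a clique: then some pair of them can be added to the matroid
  before a 1-extension. Simplicial vertices that meet no deleted edge can be discarded, and then the
  expected gain at a vertex with \<open>e\<close> deleted edges is at least \<open>d - e/2\<close>. Hence \<open>J\<close> is complete or has rank at least
  \<open>d n - |E0|\<close>, whereas a complete graph has rank at most \<open>d n - d(d+1)/2\<close>.
\<close>

section \<open>Algebraic independence\<close>

text \<open>Global rigidity concerns every placement \<open>q\<close> with the same edge lengths,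
  near or far, and its coordinates may be transcendental over those of \<open>p\<close>. A
  derivation of all reals applies to \<open>q\<close> nevertheless, so equal lengths can be
  differentiated although \<open>q\<close> is no function of \<open>p\<close>.

  The constants come from the random order. If a vertex has n neighbours, the number a preceding it
  is uniform on 0..n, and min d a has mean d - d(d+1)/(2(n+1)). This is the weight for a clique; it
  is always below d, so simplicial vertices must be discarded. For a non-clique the worst case is
  one neighbour x whose removal leaves a clique: two such neighbours would be glued along d common
  ones. The extra 1 is then earned when x is among at least d+1 predecessors, with probability 1/2 -
  d(d+1)/(2n(n+1)), and the total is at least d exactly if n >= d(d+1).

  The two halves of the theorem differ by one deleted edge because at |E0| = d(d+1)/2 the rank
  bounds merely meet: full rank suffices for rigidity, but does not make all pairs globally
  linked.\<close>

inductive rat_polyfun :: "'i set \<Rightarrow> (('i \<Rightarrow> real) \<Rightarrow> real) \<Rightarrow> bool" for I where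
  rat_polyfun_rat: "rat_polyfun I (\<lambda>_. of_rat a)"
| rat_polyfun_coord: "i \<in> I \<Longrightarrow> rat_polyfun I (\<lambda>c. c i)"
| rat_polyfun_add: "rat_polyfun I f \<Longrightarrow> rat_polyfun I g \<Longrightarrow> rat_polyfun I (\<lambda>c. f c + g c)"
| rat_polyfun_mult: "rat_polyfun I f \<Longrightarrow> rat_polyfun I g \<Longrightarrow> rat_polyfun I (\<lambda>c. f c * g c)"

lemma rat_polyfun_zero: "rat_polyfun I (\<lambda>_. 0)"
  using rat_polyfun_rat[of I 0] by simp

lemma rat_polyfun_one: "rat_polyfun I (\<lambda>_. 1)"
  using rat_polyfun_rat[of I 1] by simp

lemma rat_polyfun_uminus: "rat_polyfun I f \<Longrightarrow> rat_polyfun I (\<lambda>c. - f c)"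
  using rat_polyfun_mult[OF rat_polyfun_rat[of I "-1"], of f] by (simp add: of_rat_minus)

lemma rat_polyfun_diff: "rat_polyfun I f \<Longrightarrow> rat_polyfun I g \<Longrightarrow> rat_polyfun I (\<lambda>c. f c - g c)"
  using rat_polyfun_add[OF _ rat_polyfun_uminus, of I f g] by simp

lemma rat_polyfun_sum: "(\<And>x. x \<in> A \<Longrightarrow> rat_polyfun I (f x)) \<Longrightarrow> rat_polyfun I (\<lambda>c. \<Sum>x\<in>A. f x c)"
  by (induction A rule: infinite_finite_induct) (auto intro: rat_polyfun_zero rat_polyfun_add)

lemma rat_polyfun_tendsto:
  assumes "rat_polyfun I g" "\<And>i. i \<in> I \<Longrightarrow> ((\<lambda>x. C x i) \<longlongrightarrow> c i) F"
  shows "((\<lambda>x. g (C x)) \<longlongrightarrow> g c) F"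
  using assms(1) by induction (auto intro: tendsto_add tendsto_mult assms(2))

section \<open>Polynomial functions as values of formal polynomials\<close>

definition monomial_value :: "('i \<Rightarrow>\<^sub>0 nat) \<Rightarrow> ('i \<Rightarrow> real) \<Rightarrow> real" where
  "monomial_value m c = (\<Prod>i\<in>Poly_Mapping.keys m. c i ^ Poly_Mapping.lookup m i)"

lemma monomial_value_superset:
  "finite A \<Longrightarrow> Poly_Mapping.keys m \<subseteq> A \<Longrightarrow> monomial_value m c = (\<Prod>i\<in>A. c i ^ Poly_Mapping.lookup m i)"
  unfolding monomial_value_def
  by (rule prod.mono_neutral_left) (auto simp: in_keys_iff)

lemma monomial_value_plus: "monomial_value (m + n) c = monomial_value m c * monomial_value n c"
proof -
  let ?A = "Poly_Mapping.keys m \<union> Poly_Mapping.keys n"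
  have "monomial_value (m + n) c = (\<Prod>i\<in>?A. c i ^ Poly_Mapping.lookup (m + n) i)"
    using keys_add[of m n] by (intro monomial_value_superset) auto
  also have "\<dots> = (\<Prod>i\<in>?A. c i ^ Poly_Mapping.lookup m i) * (\<Prod>i\<in>?A. c i ^ Poly_Mapping.lookup n i)"
    by (simp add: lookup_add power_add prod.distrib)
  also have "\<dots> = monomial_value m c * monomial_value n c"
    by (simp add: monomial_value_superset[of ?A m] monomial_value_superset[of ?A n])
  finally show ?thesis .
qed

lemma eval_rat_poly_superset:
  assumes "finite A" "Poly_Mapping.keys P \<subseteq> A"
  shows "eval_rat_poly P c = (\<Sum>m\<in>A. of_rat (Poly_Mapping.lookup P m) * monomial_value m c)"
  unfolding eval_rat_poly_def monomial_value_def[symmetric] using assms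
  by (intro sum.mono_neutral_left) (auto simp: in_keys_iff)

lemma eval_rat_poly_zero: "eval_rat_poly 0 c = 0"
  by (simp add: eval_rat_poly_def)

lemma eval_rat_poly_plus: "eval_rat_poly (P + Q) c = eval_rat_poly P c + eval_rat_poly Q c"
proof -
  let ?A = "Poly_Mapping.keys P \<union> Poly_Mapping.keys Q"
  show ?thesis
    using keys_add[of P Q]
    by (simp add: eval_rat_poly_superset[of ?A] lookup_add of_rat_add ring_distribs sum.distrib)
qed

lemma eval_rat_poly_single: "eval_rat_poly (Poly_Mapping.single m a) c = of_rat a * monomial_value m c"
  by (subst eval_rat_poly_superset[of "{m}"]) auto

lemma eval_rat_poly_sum: "eval_rat_poly (\<Sum>x\<in>A. P x) c = (\<Sum>x\<in>A. eval_rat_poly (P x) c)"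
  by (induction A rule: infinite_finite_induct) (auto simp: eval_rat_poly_zero eval_rat_poly_plus)

text \<open>The closure rules of \<open>rat_polyfun\<close> reduce polynomiality of matrix entries
  and pivot products to introduction rules; this is the way back to the formal polynomials in which
  genericity is defined.\<close>

lemma rat_polyfun_imp_eval_rat_poly:
  assumes "rat_polyfun I g"
  shows "\<exists>P. (\<forall>m\<in>Poly_Mapping.keys P. Poly_Mapping.keys m \<subseteq> I) \<and> g = eval_rat_poly P"
  using assms
proof induction
  case (rat_polyfun_rat a)
  show ?case
    by (rule exI[of _ "Poly_Mapping.single 0 a"])
      (auto simp: eval_rat_poly_single monomial_value_def fun_eq_iff)
next
  case (rat_polyfun_coord i)
  then show ?case
    by (intro exI[of _ "Poly_Mapping.single (Poly_Mapping.single i 1) 1"])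
      (auto simp: eval_rat_poly_single monomial_value_def fun_eq_iff)
next
  case (rat_polyfun_add f g)
  then obtain P Q where PQ: "\<forall>m\<in>Poly_Mapping.keys P. Poly_Mapping.keys m \<subseteq> I" "f = eval_rat_poly P"
    "\<forall>m\<in>Poly_Mapping.keys Q. Poly_Mapping.keys m \<subseteq> I" "g = eval_rat_poly Q" by blast
  then show ?case
    using keys_add[of P Q] by (intro exI[of _ "P + Q"]) (auto simp: eval_rat_poly_plus fun_eq_iff; blast)
next
  case (rat_polyfun_mult f g)
  then obtain P Q where PQ: "\<forall>m\<in>Poly_Mapping.keys P. Poly_Mapping.keys m \<subseteq> I" "f = eval_rat_poly P"
    "\<forall>m\<in>Poly_Mapping.keys Q. Poly_Mapping.keys m \<subseteq> I" "g = eval_rat_poly Q" by blast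
  let ?S = "\<lambda>(m, n). Poly_Mapping.single (m + n) (Poly_Mapping.lookup P m * Poly_Mapping.lookup Q n)"
  let ?R = "\<Sum>z\<in>Poly_Mapping.keys P \<times> Poly_Mapping.keys Q. ?S z"
  have keys: "Poly_Mapping.keys m \<subseteq> I" if m: "m \<in> Poly_Mapping.keys ?R" for m
  proof -
    have "m \<in> (\<Union>z\<in>Poly_Mapping.keys P \<times> Poly_Mapping.keys Q. Poly_Mapping.keys (?S z))"
      by (rule subsetD[OF keys_sum m])
    then obtain a b where "a \<in> Poly_Mapping.keys P" "b \<in> Poly_Mapping.keys Q" "m \<in> Poly_Mapping.keys (?S (a, b))"
      by blast
    then show ?thesis
      using keys_add[of a b] PQ by (auto split: if_splits)
  qed
  have "f c * g c = eval_rat_poly ?R c" for c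
  proof -
    have "f c * g c = (\<Sum>m\<in>Poly_Mapping.keys P. of_rat (Poly_Mapping.lookup P m) * monomial_value m c) *
        (\<Sum>m\<in>Poly_Mapping.keys Q. of_rat (Poly_Mapping.lookup Q m) * monomial_value m c)"
      by (simp add: PQ eval_rat_poly_def monomial_value_def)
    also have "\<dots> = (\<Sum>m\<in>Poly_Mapping.keys P. \<Sum>n\<in>Poly_Mapping.keys Q. eval_rat_poly (?S (m, n)) c)"
      by (simp add: sum_product eval_rat_poly_single monomial_value_plus of_rat_mult mult_ac)
    also have "\<dots> = eval_rat_poly ?R c"
      by (simp add: eval_rat_poly_sum sum.cartesian_product case_prod_unfold)
    finally show ?thesis .
  qed
  then show ?case using keys by blast
qed

text \<open>Genericity is used in this form: a polynomial function that is nonzero at one freely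
  chosen point is nonzero at the generic one.\<close>

lemma alg_independent_rat_polyfun_eq_0:
  assumes "alg_independent_over_rat I c" "rat_polyfun I g" "g c = 0"
  shows "g = (\<lambda>_. 0)"
proof -
  obtain P where P: "\<forall>m\<in>Poly_Mapping.keys P. Poly_Mapping.keys m \<subseteq> I" "g = eval_rat_poly P"
    using rat_polyfun_imp_eval_rat_poly[OF assms(2)] by blast
  then have "P = 0" using assms unfolding alg_independent_over_rat_def by blast
  then show ?thesis using P by (simp add: fun_eq_iff eval_rat_poly_zero)
qed

section \<open>Existence of algebraically independent families\<close>

lemma alg_independent_over_rat_mono:
  "alg_independent_over_rat I c \<Longrightarrow> I' \<subseteq> I \<Longrightarrow> alg_independent_over_rat I' c"
  unfolding alg_independent_over_rat_def by blast

text \<open>Over finitely many variables a monomial is an exponent vector and a polynomial is a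
  finite set of pairs (monomial, coefficient).\<close>

lemma countable_rat_polys:
  assumes "finite I"
  shows "countable {P :: ('i \<Rightarrow>\<^sub>0 nat) \<Rightarrow>\<^sub>0 rat. \<forall>m\<in>Poly_Mapping.keys P. Poly_Mapping.keys m \<subseteq> I}"
    (is "countable ?Q")
proof -
  let ?M = "{m :: 'i \<Rightarrow>\<^sub>0 nat. Poly_Mapping.keys m \<subseteq> I}"
  have "inj_on (\<lambda>m. restrict (Poly_Mapping.lookup m) I) ?M"
  proof (rule inj_onI)
    fix m n assume mn: "m \<in> ?M" "n \<in> ?M"
      "restrict (Poly_Mapping.lookup m) I = restrict (Poly_Mapping.lookup n) I"
    have "Poly_Mapping.lookup m i = Poly_Mapping.lookup n i" for i
    proof (cases "i \<in> I")
      case True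
      then show ?thesis using fun_cong[OF mn(3), of i] by simp
    next
      case False
      then have "i \<notin> Poly_Mapping.keys m" "i \<notin> Poly_Mapping.keys n" using mn by auto
      then show ?thesis by (simp add: in_keys_iff)
    qed
    then show "m = n" by (simp add: poly_mapping_eqI)
  qed
  moreover have "countable ((\<lambda>m. restrict (Poly_Mapping.lookup m) I) ` ?M)"
    by (rule countable_subset[OF _ countable_PiE[OF assms, of "\<lambda>_. UNIV"]]) auto
  ultimately have M: "countable ?M"
    by (rule countable_image_inj_on[rotated])
  let ?g = "\<lambda>P :: ('i \<Rightarrow>\<^sub>0 nat) \<Rightarrow>\<^sub>0 rat. (\<lambda>m. (m, Poly_Mapping.lookup P m)) ` Poly_Mapping.keys P"
  have "inj_on ?g ?Q"
  proof (rule inj_onI)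
    fix P P' assume eq: "?g P = ?g P'"
    have "Poly_Mapping.lookup P m = Poly_Mapping.lookup P' m" for m
    proof (cases "m \<in> Poly_Mapping.keys P \<or> m \<in> Poly_Mapping.keys P'")
      case True
      then have "(m, Poly_Mapping.lookup P m) \<in> ?g P' \<or> (m, Poly_Mapping.lookup P' m) \<in> ?g P"
        using eq by blast
      then show ?thesis by auto
    qed (simp add: in_keys_iff)
    then show "P = P'" by (simp add: poly_mapping_eqI)
  qed
  moreover have "countable (?g ` ?Q)"
    by (rule countable_subset[OF _ countable_Collect_finite_subset[of "?M \<times> UNIV"]])
      (use M in auto)
  ultimately show ?thesis
    by (rule countable_image_inj_on[rotated])
qed

text \<open>Substituting \<open>c\<close> for the old variables leaves a real polynomial in
  \<open>t\<close>. Its coefficients are rational polynomials evaluated at \<open>c\<close>, and by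
  independence a nonzero one of these does not vanish.\<close>

lemma finite_roots_fresh_coordinate:
  assumes indep: "alg_independent_over_rat I c" and j: "j \<notin> I"
    and P: "\<forall>m\<in>Poly_Mapping.keys P. Poly_Mapping.keys m \<subseteq> insert j I" "P \<noteq> 0"
  shows "finite {t. eval_rat_poly P (c(j := t)) = 0}"
proof -
  define strip :: "('a \<Rightarrow>\<^sub>0 nat) \<Rightarrow> 'a \<Rightarrow>\<^sub>0 nat" where "strip m = Poly_Mapping.update j 0 m" for m
  have strip_lookup: "Poly_Mapping.lookup (strip m) i = (if i = j then 0 else Poly_Mapping.lookup m i)" for m i
    by (simp add: strip_def lookup_update)
  have strip_keys: "Poly_Mapping.keys (strip m) = Poly_Mapping.keys m - {j}" for m
    by (auto simp: in_keys_iff strip_lookup split: if_splits)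
  have strip_inj: "m = n" if "strip m = strip n" "Poly_Mapping.lookup m j = Poly_Mapping.lookup n j" for m n
  proof (rule poly_mapping_eqI)
    fix i show "Poly_Mapping.lookup m i = Poly_Mapping.lookup n i"
      using that strip_lookup[of m i] strip_lookup[of n i] by (cases "i = j") auto
  qed
  have val: "monomial_value m (c(j := t)) = t ^ Poly_Mapping.lookup m j * monomial_value (strip m) c" for m t
  proof -
    have "monomial_value m (c(j := t)) =
        (\<Prod>i\<in>insert j (Poly_Mapping.keys m). (c(j := t)) i ^ Poly_Mapping.lookup m i)"
      by (rule monomial_value_superset) auto
    also have "\<dots> = t ^ Poly_Mapping.lookup m j *
        (\<Prod>i\<in>Poly_Mapping.keys m - {j}. (c(j := t)) i ^ Poly_Mapping.lookup m i)"
      by (subst prod.insert_remove) auto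
    also have "(\<Prod>i\<in>Poly_Mapping.keys m - {j}. (c(j := t)) i ^ Poly_Mapping.lookup m i) =
        monomial_value (strip m) c"
      unfolding monomial_value_def strip_keys by (rule prod.cong) (auto simp: strip_lookup)
    finally show ?thesis .
  qed
  define f :: "real poly" where "f = (\<Sum>m\<in>Poly_Mapping.keys P.
    monom (of_rat (Poly_Mapping.lookup P m) * monomial_value (strip m) c) (Poly_Mapping.lookup m j))"
  have eval: "eval_rat_poly P (c(j := t)) = poly f t" for t
    unfolding eval_rat_poly_def monomial_value_def[symmetric] val f_def
    by (simp add: poly_sum poly_monom mult_ac)
  obtain m0 where m0: "m0 \<in> Poly_Mapping.keys P" using P(2) by (metis keys_eq_empty equals0I)
  \<comment> \<open>Any exponent of the new variable that occurs in \<open>P\<close> will do: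
    monomials sharing it stay distinct after stripping, so the coefficient of \<open>m0\<close>
    cannot cancel in \<open>Pk\<close>.\<close>
  let ?k = "Poly_Mapping.lookup m0 j"
  let ?K = "{m \<in> Poly_Mapping.keys P. Poly_Mapping.lookup m j = ?k}"
  define Pk where "Pk = (\<Sum>m\<in>?K. Poly_Mapping.single (strip m) (Poly_Mapping.lookup P m))"
  have "coeff f ?k = (\<Sum>m\<in>Poly_Mapping.keys P. if Poly_Mapping.lookup m j = ?k
      then of_rat (Poly_Mapping.lookup P m) * monomial_value (strip m) c else 0)"
    by (simp add: f_def coeff_sum)
  also have "\<dots> = (\<Sum>m\<in>?K. of_rat (Poly_Mapping.lookup P m) * monomial_value (strip m) c)"
    by (simp add: sum.inter_filter)
  also have "\<dots> = eval_rat_poly Pk c"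
    by (simp add: Pk_def eval_rat_poly_sum eval_rat_poly_single)
  finally have coeff: "coeff f ?k = eval_rat_poly Pk c" .
  have "Poly_Mapping.lookup Pk (strip m0) =
      (\<Sum>m\<in>?K. if m = m0 then Poly_Mapping.lookup P m else 0)"
    unfolding Pk_def lookup_sum
    by (rule sum.cong) (use strip_inj in \<open>auto simp: lookup_single when_def\<close>)
  also have "\<dots> = Poly_Mapping.lookup P m0" using m0 by simp
  finally have "Pk \<noteq> 0" using m0 by (auto simp: in_keys_iff)
  moreover have "Poly_Mapping.keys m \<subseteq> I" if m: "m \<in> Poly_Mapping.keys Pk" for m
  proof -
    have "m \<in> (\<Union>x\<in>?K. Poly_Mapping.keys (Poly_Mapping.single (strip x) (Poly_Mapping.lookup P x)))"
      using m unfolding Pk_def by (rule subsetD[OF keys_sum])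
    then obtain x where "x \<in> ?K" "m = strip x" by (auto split: if_splits)
    then show ?thesis using P(1) strip_keys[of x] by auto
  qed
  ultimately have "eval_rat_poly Pk c \<noteq> 0"
    using indep unfolding alg_independent_over_rat_def by blast
  then have "f \<noteq> 0" using coeff by auto
  then show ?thesis by (simp add: eval poly_roots_finite)
qed

text \<open>Coordinates are chosen one at a time. A new value only has to avoid finitely many roots
  of each of countably many polynomials, and the reals are uncountable.\<close>

lemma alg_independent_exists:
  assumes "finite I"
  shows "\<exists>c. alg_independent_over_rat I c"
  using assms
proof (induction I rule: finite_induct)
  case empty
  have "P = 0" if P: "\<forall>m\<in>Poly_Mapping.keys P. Poly_Mapping.keys m \<subseteq> {}" "eval_rat_poly P (\<lambda>_. 0) = 0"
    for P :: "('i \<Rightarrow>\<^sub>0 nat) \<Rightarrow>\<^sub>0 rat"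
  proof -
    have "Poly_Mapping.keys P \<subseteq> {0}" using P(1) by auto
    then have "eval_rat_poly P (\<lambda>_. 0) = of_rat (Poly_Mapping.lookup P 0)"
      by (subst eval_rat_poly_superset[of "{0}"]) (auto simp: monomial_value_def)
    then have "Poly_Mapping.lookup P 0 = 0" using P(2) by simp
    then have "0 \<notin> Poly_Mapping.keys P" by (simp add: in_keys_iff)
    then have "Poly_Mapping.keys P = {}" using \<open>Poly_Mapping.keys P \<subseteq> {0}\<close> by blast
    then show ?thesis by simp
  qed
  then show ?case unfolding alg_independent_over_rat_def by blast
next
  case (insert j I)
  then obtain c where c: "alg_independent_over_rat I c" by blast
  let ?Q = "{P. \<forall>m\<in>Poly_Mapping.keys P. Poly_Mapping.keys m \<subseteq> insert j I}"
  define B where "B = (\<Union>P\<in>?Q - {0}. {t. eval_rat_poly P (c(j := t)) = 0})"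
  have "countable B"
    unfolding B_def using insert.hyps countable_rat_polys[of "insert j I"] finite_roots_fresh_coordinate[OF c]
    by (intro countable_UN) (auto intro: countable_finite)
  then have "B \<noteq> UNIV" using uncountable_UNIV_real by auto
  then obtain t where "t \<notin> B" by blast
  then have "alg_independent_over_rat (insert j I) (c(j := t))"
    unfolding alg_independent_over_rat_def B_def by blast
  then show ?case by blast
qed

section \<open>Derivations of the reals\<close>

definition derivation :: "(real \<Rightarrow> real) \<Rightarrow> bool" where
  "derivation D \<longleftrightarrow> (\<forall>a b. D (a + b) = D a + D b) \<and> (\<forall>a b. D (a * b) = a * D b + D a * b)"

text \<open>A derivation on a subring of the reals, encoded by its graph so that extension is
  inclusion and Zorn's lemma applies. The domain need not be a field, so the extension argument
  avoids division in it.\<close>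

definition derivation_graph :: "(real \<times> real) set \<Rightarrow> bool" where
  "derivation_graph G \<longleftrightarrow> (1, 0) \<in> G \<and>
     (\<forall>a b b'. (a, b) \<in> G \<longrightarrow> (a, b') \<in> G \<longrightarrow> b = b') \<and>
     (\<forall>a a'. (a, a') \<in> G \<longrightarrow> (- a, - a') \<in> G) \<and>
     (\<forall>a a' b b'. (a, a') \<in> G \<longrightarrow> (b, b') \<in> G \<longrightarrow>
        (a + b, a' + b') \<in> G \<and> (a * b, a * b' + a' * b) \<in> G)"

context
  fixes G assumes G: "derivation_graph G"
begin

lemma graph_unique: "(a, b) \<in> G \<Longrightarrow> (a, b') \<in> G \<Longrightarrow> b = b'"
  and graph_uminus: "(a, a') \<in> G \<Longrightarrow> (- a, - a') \<in> G"
  and graph_add: "(a, a') \<in> G \<Longrightarrow> (b, b') \<in> G \<Longrightarrow> (a + b, a' + b') \<in> G"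
  and graph_mult: "(a, a') \<in> G \<Longrightarrow> (b, b') \<in> G \<Longrightarrow> (a * b, a * b' + a' * b) \<in> G"
  and graph_one: "(1, 0) \<in> G"
  using G unfolding derivation_graph_def by blast+

lemma graph_zero: "(0, 0) \<in> G"
  using graph_add[OF graph_one graph_uminus[OF graph_one]] by simp

lemma graph_sum: "(\<And>x. x \<in> A \<Longrightarrow> (f x, f' x) \<in> G) \<Longrightarrow> (sum f A, sum f' A) \<in> G"
  by (induction A rule: infinite_finite_induct) (auto intro: graph_zero graph_add)

lemma graph_of_nat_mult: "(a, a') \<in> G \<Longrightarrow> (of_nat n * a, of_nat n * a') \<in> G"
proof (induction n)
  case (Suc n)
  then show ?case using graph_add[of a a' "of_nat n * a" "of_nat n * a'"] by (simp add: algebra_simps)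
qed (simp add: graph_zero)

text \<open>A polynomial over the ring \<open>Domain G\<close>, paired with its coefficientwise derivative.\<close>

definition poly_graph :: "(real poly \<times> real poly) set" where
  "poly_graph = {(a, a'). \<forall>k. (coeff a k, coeff a' k) \<in> G}"

lemma poly_graph_const: "(s, s') \<in> G \<Longrightarrow> ([:s:], [:s':]) \<in> poly_graph"
  by (auto simp: poly_graph_def coeff_pCons graph_zero split: nat.splits)

lemma poly_graph_X: "([:0, 1:], 0) \<in> poly_graph"
  by (auto simp: poly_graph_def coeff_pCons graph_zero graph_one split: nat.splits)

lemma poly_graph_monom: "(s, s') \<in> G \<Longrightarrow> (monom s k, monom s' k) \<in> poly_graph"
  by (auto simp: poly_graph_def graph_zero)

lemma poly_graph_add: "(a, a') \<in> poly_graph \<Longrightarrow> (b, b') \<in> poly_graph \<Longrightarrow> (a + b, a' + b') \<in> poly_graph"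
  by (auto simp: poly_graph_def graph_add)

lemma poly_graph_uminus: "(a, a') \<in> poly_graph \<Longrightarrow> (- a, - a') \<in> poly_graph"
  by (auto simp: poly_graph_def graph_uminus)

lemma poly_graph_mult:
  "(a, a') \<in> poly_graph \<Longrightarrow> (b, b') \<in> poly_graph \<Longrightarrow> (a * b, a * b' + a' * b) \<in> poly_graph"
  by (auto simp: poly_graph_def coeff_mult sum.distrib[symmetric] intro!: graph_sum graph_mult)

lemma poly_graph_pderiv: "(a, a') \<in> poly_graph \<Longrightarrow> (pderiv a, pderiv a') \<in> poly_graph"
  by (auto simp: poly_graph_def coeff_pderiv simp del: of_nat_Suc intro: graph_of_nat_mult)

lemma poly_graph_zero: "(0, a') \<in> poly_graph \<Longrightarrow> a' = 0"
  using graph_unique[OF graph_zero] by (auto simp: poly_graph_def poly_eq_iff)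

text \<open>The only possible value of the extended derivation at \<open>poly a x\<close>, if \<open>x\<close> is sent to \<open>w\<close>.\<close>

definition ext_value :: "real \<Rightarrow> real \<Rightarrow> real poly \<Rightarrow> real poly \<Rightarrow> real" where
  "ext_value x w a a' = poly a' x + poly (pderiv a) x * w"

lemma ext_value_add: "ext_value x w (a + b) (a' + b') = ext_value x w a a' + ext_value x w b b'"
  by (simp add: ext_value_def pderiv_add algebra_simps)

lemma ext_value_uminus: "ext_value x w (- a) (- a') = - ext_value x w a a'"
  by (simp add: ext_value_def pderiv_minus)

lemma ext_value_mult:
  "ext_value x w (a * b) (a * b' + a' * b) = poly a x * ext_value x w b b' + ext_value x w a a' * poly b x"
  by (simp add: ext_value_def pderiv_mult algebra_simps)

text \<open>If no nonzero polynomial over the domain vanishes at \<open>x\<close>, every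
  \<open>w\<close> works. Otherwise a vanishing polynomial \<open>m\<close> of least degree forces
  \<open>w\<close>, and all other vanishing polynomials are handled by pseudo-division by
  \<open>m\<close>.\<close>

lemma ext_value_well_defined:
  "\<exists>w. \<forall>(a, a')\<in>poly_graph. poly a x = 0 \<longrightarrow> ext_value x w a a' = 0"
proof (cases "\<exists>(a, a')\<in>poly_graph. a \<noteq> 0 \<and> poly a x = 0")
  case False
  then have "ext_value x 0 a a' = 0" if "(a, a') \<in> poly_graph" "poly a x = 0" for a a'
    using that poly_graph_zero[of a'] by (auto simp: ext_value_def)
  then show ?thesis by blast
next
  case True
  define S where "S = {z \<in> poly_graph. fst z \<noteq> 0 \<and> poly (fst z) x = 0}"
  have "S \<noteq> {}" using True by (auto simp: S_def)
  then obtain z where z: "z \<in> S" and zmin: "\<And>y. y \<in> S \<Longrightarrow> degree (fst z) \<le> degree (fst y)"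
    using ex_has_least_nat[of "\<lambda>z. z \<in> S" _ "\<lambda>z. degree (fst z)"] by blast
  obtain m m' where m: "(m, m') \<in> poly_graph" "m \<noteq> 0" "poly m x = 0"
    and zm: "z = (m, m')"
    using z by (cases z) (auto simp: S_def)
  have min: "degree m \<le> degree a" if "(a, a') \<in> poly_graph" "a \<noteq> 0" "poly a x = 0" for a a'
    using zmin[of "(a, a')"] that by (simp add: S_def zm)
  have deg: "degree m > 0"
  proof (rule ccontr)
    assume "\<not> degree m > 0"
    then obtain s where "m = [:s:]" using degree_eq_zeroE[of m] by auto
    then show False using m by simp
  qed
  have "pderiv m \<noteq> 0" using deg by (simp add: pderiv_eq_0_iff)
  then have nz: "poly (pderiv m) x \<noteq> 0"
    using min[OF poly_graph_pderiv[OF m(1)]] deg by (auto simp: degree_pderiv)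
  \<comment> \<open>The only value compatible with differentiating \<open>poly m x = 0\<close>. The
    denominator is nonzero because \<open>pderiv m\<close> is nonzero of smaller degree than
    \<open>m\<close>.\<close>
  define w where "w = - poly m' x / poly (pderiv m) x"
  have m0: "ext_value x w m m' = 0" using nz by (simp add: ext_value_def w_def)
  have "ext_value x w a a' = 0" if "(a, a') \<in> poly_graph" "poly a x = 0" for a a'
    using that
  proof (induction "degree a" arbitrary: a a' rule: less_induct)
    case less
    show ?case
    proof (cases "a = 0")
      case True
      then show ?thesis using less poly_graph_zero[of a'] by (auto simp: ext_value_def)
    next
      case False
      define k where "k = degree a - degree m"
      have le: "degree m \<le> degree a" using min less False by blast
      let ?l = "lead_coeff m" let ?l' = "coeff m' (degree m)"
      let ?s = "lead_coeff a" let ?s' = "coeff a' (degree a)"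
      have lG: "(?l, ?l') \<in> G" "(?s, ?s') \<in> G" using m less by (auto simp: poly_graph_def)
      \<comment> \<open>One pseudo-division step: \<open>a\<close> is multiplied by the leading
        coefficient of \<open>m\<close>, which need not be invertible in the domain, and the leading
        terms cancel. \<open>b'\<close> follows by the Leibniz rule.\<close>
      define b where "b = [:?l:] * a + - (monom ?s k * m)"
      define b' where "b' = ([:?l:] * a' + [:?l':] * a) + - (monom ?s k * m' + monom ?s' k * m)"
      have bG: "(b, b') \<in> poly_graph" unfolding b_def b'_def
        using lG less.prems m by (intro poly_graph_add poly_graph_uminus poly_graph_mult
            poly_graph_const poly_graph_monom) auto
      have b0: "poly b x = 0" using less.prems m by (simp add: b_def)
      have "coeff b (degree a) = 0"
        using le by (simp add: b_def coeff_monom_mult k_def)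
      moreover have "degree b \<le> degree a"
      proof -
        have "degree (monom ?s k * m) \<le> degree a"
          by (rule order.trans[OF degree_mult_le]) (use le degree_monom_le[of ?s k] in \<open>auto simp: k_def\<close>)
        then show ?thesis unfolding b_def by (auto intro!: degree_diff_le)
      qed
      ultimately have "b = 0 \<or> degree b < degree a"
        by (metis leading_coeff_0_iff le_neq_implies_less)
      then have "ext_value x w b b' = 0"
        using less.hyps[OF _ bG b0] bG poly_graph_zero[of b'] by (auto simp: ext_value_def)
      moreover have "ext_value x w b b' = ?l * ext_value x w a a'"
        unfolding b_def b'_def ext_value_add ext_value_uminus ext_value_mult
        using m m0 less.prems by simp
      moreover have "?l \<noteq> 0" using m by simp
      ultimately show ?thesis by simp
    qed
  qed
  then show ?thesis by blast
qed

text \<open>The new domain consists of the values at \<open>x\<close> of polynomials over the old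
  one. Two polynomials with the same value have a difference vanishing at \<open>x\<close>, and
  \<open>w\<close> was chosen so that its derivative is zero there.\<close>

lemma derivation_graph_adjoin: "\<exists>G'. derivation_graph G' \<and> G \<subseteq> G' \<and> x \<in> Domain G'"
proof -
  obtain w where w: "\<And>a a'. (a, a') \<in> poly_graph \<Longrightarrow> poly a x = 0 \<Longrightarrow> ext_value x w a a' = 0"
    using ext_value_well_defined[of x] by blast
  define G' where "G' = {(poly a x, ext_value x w a a') | a a'. (a, a') \<in> poly_graph}"
  have in_G': "(poly a x, ext_value x w a a') \<in> G'" if "(a, a') \<in> poly_graph" for a a'
    using that by (auto simp: G'_def)
  have sub: "G \<subseteq> G'"
  proof safe
    fix s s' assume "(s, s') \<in> G"
    from in_G'[OF poly_graph_const[OF this]] show "(s, s') \<in> G'" by (simp add: ext_value_def pderiv_pCons)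
  qed
  have unique: "b = b'" if ab: "(a, b) \<in> G'" "(a, b') \<in> G'" for a b b'
  proof -
    obtain p p' q q' where pq: "(p, p') \<in> poly_graph" "a = poly p x" "b = ext_value x w p p'"
      "(q, q') \<in> poly_graph" "a = poly q x" "b' = ext_value x w q q'"
      using ab unfolding G'_def by blast
    then have "ext_value x w (p + - q) (p' + - q') = 0"
      by (intro w poly_graph_add poly_graph_uminus) auto
    then show ?thesis using pq by (simp only: ext_value_add ext_value_uminus)
  qed
  have "derivation_graph G'"
    unfolding derivation_graph_def
  proof (intro conjI allI impI)
    show "(1, 0) \<in> G'" using sub graph_one by blast
  next
    fix a b b' assume "(a, b) \<in> G'" "(a, b') \<in> G'" then show "b = b'" by (rule unique)
  next
    fix a a' assume "(a, a') \<in> G'"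
    then obtain p p' where p: "(p, p') \<in> poly_graph" "a = poly p x" "a' = ext_value x w p p'"
      by (auto simp: G'_def)
    from in_G'[OF poly_graph_uminus[OF p(1)]] show "(- a, - a') \<in> G'"
      by (simp add: p ext_value_uminus)
  next
    fix a a' b b' assume "(a, a') \<in> G'" "(b, b') \<in> G'"
    then obtain p p' q q' where pq: "(p, p') \<in> poly_graph" "a = poly p x" "a' = ext_value x w p p'"
      "(q, q') \<in> poly_graph" "b = poly q x" "b' = ext_value x w q q'"
      by (auto simp: G'_def)
    show "(a + b, a' + b') \<in> G'"
      using in_G'[OF poly_graph_add[OF pq(1,4)]] by (simp add: pq ext_value_add)
    show "(a * b, a * b' + a' * b) \<in> G'"
      using in_G'[OF poly_graph_mult[OF pq(1,4)]] unfolding pq ext_value_mult by simp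
  qed
  moreover have "(x, w) \<in> G'"
    using in_G'[OF poly_graph_X] by (simp add: ext_value_def pderiv_pCons)
  ultimately show ?thesis using sub by blast
qed

end

text \<open>Unions of chains are again derivation graphs, so a maximal extension exists; it is total
  because a missing number could be adjoined.\<close>

lemma derivation_graph_extends:
  assumes "derivation_graph G"
  shows "\<exists>D. derivation D \<and> (\<forall>(a, b)\<in>G. D a = b)"
proof -
  let ?A = "{H. derivation_graph H \<and> G \<subseteq> H}"
  have "\<exists>M\<in>?A. \<forall>X\<in>?A. M \<subseteq> X \<longrightarrow> X = M"
  proof (rule subset_Zorn_nonempty)
    show "?A \<noteq> {}" using assms by blast
    fix C assume "C \<noteq> {}" and chain: "subset.chain ?A C"
    have C: "\<And>X. X \<in> C \<Longrightarrow> derivation_graph X \<and> G \<subseteq> X"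
      "\<And>X Y. X \<in> C \<Longrightarrow> Y \<in> C \<Longrightarrow> X \<subseteq> Y \<or> Y \<subseteq> X"
      using chain unfolding subset.chain_def by blast+
    have two: "\<exists>X\<in>C. y \<in> X \<and> z \<in> X" if "y \<in> \<Union>C" "z \<in> \<Union>C" for y z
      using that C(2) by blast
    have "derivation_graph (\<Union>C)"
      unfolding derivation_graph_def
    proof (intro conjI allI impI)
      show "(1, 0) \<in> \<Union>C" using \<open>C \<noteq> {}\<close> C(1) graph_one by blast
    next
      fix a b b' assume "(a, b) \<in> \<Union>C" "(a, b') \<in> \<Union>C"
      then show "b = b'" using two C(1) graph_unique by meson
    next
      fix a a' assume "(a, a') \<in> \<Union>C"
      then show "(- a, - a') \<in> \<Union>C" using C(1) graph_uminus by blast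
    next
      fix a a' b b' assume "(a, a') \<in> \<Union>C" "(b, b') \<in> \<Union>C"
      then obtain X where "X \<in> C" "(a, a') \<in> X" "(b, b') \<in> X" using two by blast
      then show "(a + b, a' + b') \<in> \<Union>C" "(a * b, a * b' + a' * b) \<in> \<Union>C"
        using C(1) graph_add graph_mult by blast+
    qed
    then show "\<Union>C \<in> ?A" using C(1) \<open>C \<noteq> {}\<close> by blast
  qed
  then obtain M where MA: "M \<in> ?A" and MX: "\<forall>X\<in>?A. M \<subseteq> X \<longrightarrow> X = M" by (rule bexE)
  have M: "derivation_graph M" "G \<subseteq> M" using MA by simp_all
  have "\<exists>y. (x, y) \<in> M" for x
  proof -
    obtain M' where M': "derivation_graph M'" "M \<subseteq> M'" "x \<in> Domain M'"
      using derivation_graph_adjoin[OF M(1), of x] by (elim exE conjE)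
    then have "M' = M" using MX M(2) by simp
    then show ?thesis using M'(3) by (simp add: Domain_iff)
  qed
  then obtain D where D: "\<And>x. (x, D x) \<in> M" by metis
  have D_eq: "D a = b" if "(a, b) \<in> M" for a b
    using graph_unique[OF M(1) D that] .
  have "derivation D"
    unfolding derivation_def
    using D graph_add[OF M(1)] graph_mult[OF M(1)] by (intro conjI allI D_eq) auto
  then show ?thesis using D_eq M(2) by blast
qed

text \<open>On polynomial values at \<open>c\<close> the derivation is the directional derivative
  along \<open>w\<close>. This is well defined because, by independence, a value at \<open>c\<close>
  determines the polynomial function.\<close>

lemma alg_independent_derivation:
  assumes "alg_independent_over_rat I c"
  shows "\<exists>D. derivation D \<and> (\<forall>i\<in>I. D (c i) = w i)"
proof -
  define line where "line t i = c i + t * w i" for t i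
  have line0: "line 0 = c" by (simp add: line_def fun_eq_iff)
  define G where "G = {(g c, g') | g g'. rat_polyfun I g \<and> ((\<lambda>t. g (line t)) has_real_derivative g') (at 0)}"
  have in_G: "(g c, g') \<in> G" if "rat_polyfun I g" "((\<lambda>t. g (line t)) has_real_derivative g') (at 0)" for g g'
    using that by (auto simp: G_def)
  have "derivation_graph G"
    unfolding derivation_graph_def
  proof (intro conjI allI impI)
    show "(1, 0) \<in> G" by (rule in_G[OF rat_polyfun_one]) simp
  next
    fix a b b' assume "(a, b) \<in> G" "(a, b') \<in> G"
    then obtain g h where gh: "rat_polyfun I g" "((\<lambda>t. g (line t)) has_real_derivative b) (at 0)" "a = g c"
      "rat_polyfun I h" "((\<lambda>t. h (line t)) has_real_derivative b') (at 0)" "a = h c"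
      by (auto simp: G_def)
    have "(\<lambda>x. g x - h x) = (\<lambda>_. 0)"
      using gh by (intro alg_independent_rat_polyfun_eq_0[OF assms] rat_polyfun_diff) auto
    then have "g = h" by (simp add: fun_eq_iff)
    then show "b = b'" using gh DERIV_unique by blast
  next
    fix a a' assume "(a, a') \<in> G"
    then obtain g where g: "rat_polyfun I g" "((\<lambda>t. g (line t)) has_real_derivative a') (at 0)" "a = g c"
      by (auto simp: G_def)
    show "(- a, - a') \<in> G"
      unfolding g(3) by (intro in_G rat_polyfun_uminus g DERIV_minus)
  next
    fix a a' b b' assume "(a, a') \<in> G" "(b, b') \<in> G"
    then obtain g h where gh: "rat_polyfun I g" "((\<lambda>t. g (line t)) has_real_derivative a') (at 0)" "a = g c"
      "rat_polyfun I h" "((\<lambda>t. h (line t)) has_real_derivative b') (at 0)" "b = h c"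
      by (auto simp: G_def)
    show "(a + b, a' + b') \<in> G"
      unfolding gh(3,6) by (intro in_G rat_polyfun_add gh DERIV_add)
    show "(a * b, a * b' + a' * b) \<in> G"
      unfolding gh(3,6)
      using DERIV_mult'[OF gh(2,5)] by (intro in_G rat_polyfun_mult gh) (simp add: line0)
  qed
  from derivation_graph_extends[OF this]
  obtain D where D: "derivation D" "\<forall>(a, b)\<in>G. D a = b" by blast
  have "(c i, w i) \<in> G" if "i \<in> I" for i
    by (rule in_G[OF rat_polyfun_coord[OF that]]) (auto simp: line_def intro!: derivative_eq_intros)
  then have "\<forall>i\<in>I. D (c i) = w i" using D(2) by fast
  then show ?thesis using D(1) by (intro exI conjI)
qed

section \<open>Linear independence at generic points\<close>

text \<open>Independence of a family, so equal vectors at different indices count as dependent;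
  \<open>K\<close> is the set of coordinates.\<close>

definition indep_family :: "'e set \<Rightarrow> 'k set \<Rightarrow> ('e \<Rightarrow> 'k \<Rightarrow> real) \<Rightarrow> bool" where
  "indep_family F K v \<longleftrightarrow>
     (\<forall>l. (\<forall>k\<in>K. (\<Sum>e\<in>F. l e * v e k) = 0) \<longrightarrow> (\<forall>e\<in>F. l e = 0))"

text \<open>Fraction-free Gaussian elimination: the product of the pivots is the polynomial \<open>\<delta>\<close>.\<close>

lemma indep_family_witness:
  assumes "finite F" "\<And>e k. e \<in> F \<Longrightarrow> k \<in> K \<Longrightarrow> rat_polyfun I (\<lambda>c. r c e k)"
    and "indep_family F K (r q)"
  shows "\<exists>\<delta>. rat_polyfun I \<delta> \<and> \<delta> q \<noteq> 0 \<and> (\<forall>c. \<delta> c \<noteq> 0 \<longrightarrow> indep_family F K (r c))"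
  using assms
proof (induction F arbitrary: r rule: finite_induct)
  case empty
  show ?case by (rule exI[of _ "\<lambda>_. 1"]) (simp add: rat_polyfun_one indep_family_def)
next
  case (insert e F)
  have "\<exists>k\<in>K. r q e k \<noteq> 0"
  proof (rule ccontr)
    assume "\<not> (\<exists>k\<in>K. r q e k \<noteq> 0)"
    then have "\<forall>k\<in>K. (\<Sum>f\<in>insert e F. (if f = e then 1 else 0) * r q f k) = 0"
      using insert.hyps by (auto intro!: sum.neutral)
    then have "\<forall>f\<in>insert e F. (if f = e then 1 else 0 :: real) = 0"
      using insert.prems(2)[unfolded indep_family_def, rule_format, of "\<lambda>f. if f = e then 1 else 0"] by blast
    then show False by simp
  qed
  then obtain k where k: "k \<in> K" "r q e k \<noteq> 0" by blast
  \<comment> \<open>The row operation that clears column \<open>k\<close> by row \<open>e\<close>,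
    multiplied through by the pivot so that the entries remain polynomial.\<close>
  define s where "s c f j = r c e k * r c f j - r c f k * r c e j" for c f j
  have s_poly: "rat_polyfun I (\<lambda>c. s c f j)" if "f \<in> F" "j \<in> K" for f j
    unfolding s_def using that k insert.prems(1)
    by (intro rat_polyfun_diff rat_polyfun_mult) auto
  have s_sum: "(\<Sum>f\<in>F. l f * s c f j) = r c e k * (\<Sum>f\<in>F. l f * r c f j) - (\<Sum>f\<in>F. l f * r c f k) * r c e j"
    for c l j
    by (simp add: s_def algebra_simps sum_subtractf sum_distrib_left sum_distrib_right)
  have "indep_family F K (s q)"
    unfolding indep_family_def
  proof (intro allI impI)
    fix l assume l: "\<forall>j\<in>K. (\<Sum>f\<in>F. l f * s q f j) = 0"
    \<comment> \<open>Lifts a relation among the reduced rows to the original ones: the pivot scales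
      the coefficients, and the coefficient at \<open>e\<close> supplies the subtracted
      terms.\<close>
    define l' where "l' f = (if f = e then - (\<Sum>f\<in>F. l f * r q f k) else r q e k * l f)" for f
    have l'F: "(\<Sum>f\<in>F. l' f * r q f j) = r q e k * (\<Sum>f\<in>F. l f * r q f j)" for j
      unfolding sum_distrib_left using insert.hyps
      by (intro sum.cong) (auto simp: l'_def)
    have "\<forall>j\<in>K. (\<Sum>f\<in>insert e F. l' f * r q f j) = 0"
      using l insert.hyps by (simp add: l'F s_sum) (simp add: l'_def)
    then have "\<forall>f\<in>insert e F. l' f = 0"
      using insert.prems(2) unfolding indep_family_def by blast
    then show "\<forall>f\<in>F. l f = 0" using k insert.hyps by (auto simp: l'_def split: if_splits)
  qed
  from insert.IH[OF s_poly this] obtain \<delta> where \<delta>: "rat_polyfun I \<delta>" "\<delta> q \<noteq> 0"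
    "\<And>c. \<delta> c \<noteq> 0 \<Longrightarrow> indep_family F K (s c)" by blast
  have "indep_family (insert e F) K (r c)" if "\<delta> c * r c e k \<noteq> 0" for c
    unfolding indep_family_def
  proof (intro allI impI)
    fix l assume l: "\<forall>j\<in>K. (\<Sum>f\<in>insert e F. l f * r c f j) = 0"
    have l': "(\<Sum>f\<in>F. l f * r c f j) = - l e * r c e j" if "j \<in> K" for j
      using l that insert.hyps by (simp add: eq_neg_iff_add_eq_0 add.commute)
    have "\<forall>j\<in>K. (\<Sum>f\<in>F. l f * s c f j) = 0"
      using k by (simp add: s_sum l')
    then have F0: "\<forall>f\<in>F. l f = 0" using \<delta>(3)[of c] that unfolding indep_family_def by auto
    then have "l e = 0" using l'[OF k(1)] that by simp
    then show "\<forall>f\<in>insert e F. l f = 0" using F0 by simp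
  qed
  moreover have "rat_polyfun I (\<lambda>c. \<delta> c * r c e k)"
    using \<delta>(1) insert.prems(1) k by (intro rat_polyfun_mult) auto
  moreover have "\<delta> q * r q e k \<noteq> 0" using \<delta>(2) k by simp
  ultimately show ?case by (intro exI[of _ "\<lambda>c. \<delta> c * r c e k"]) auto
qed

lemma indep_family_generic:
  assumes "finite F" "\<And>e k. e \<in> F \<Longrightarrow> k \<in> K \<Longrightarrow> rat_polyfun I (\<lambda>c. r c e k)"
    and "indep_family F K (r q)" and "alg_independent_over_rat I c"
  shows "indep_family F K (r c)"
proof -
  have "\<exists>\<delta>. rat_polyfun I \<delta> \<and> \<delta> q \<noteq> 0 \<and> (\<forall>c. \<delta> c \<noteq> 0 \<longrightarrow> indep_family F K (r c))"
    by (rule indep_family_witness[of F K I r q]) (use assms in auto)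
  then obtain \<delta> where \<delta>: "rat_polyfun I \<delta>" "\<delta> q \<noteq> 0" "\<And>c. \<delta> c \<noteq> 0 \<Longrightarrow> indep_family F K (r c)"
    by blast
  have "\<delta> c \<noteq> 0"
    using alg_independent_rat_polyfun_eq_0[OF assms(4) \<delta>(1)] \<delta>(2) by auto
  then show ?thesis by (rule \<delta>(3))
qed

section \<open>The rigidity matroid of a generic placement\<close>

definition vec_indep :: "'w set \<Rightarrow> ('w \<Rightarrow> real ^ 'd::finite) \<Rightarrow> bool" where
  "vec_indep X a \<longleftrightarrow> (\<forall>l. (\<Sum>x\<in>X. l x *\<^sub>R a x) = 0 \<longrightarrow> (\<forall>x\<in>X. l x = 0))"

lemma vec_indepD: "vec_indep X a \<Longrightarrow> (\<Sum>x\<in>X. l x *\<^sub>R a x) = 0 \<Longrightarrow> x \<in> X \<Longrightarrow> l x = 0"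
  unfolding vec_indep_def by blast

lemma vec_indep_inj_independent:
  assumes "finite X" "vec_indep X a"
  shows "inj_on a X" "independent (a ` X)"
proof -
  show inj: "inj_on a X"
  proof (rule inj_onI, rule ccontr)
    fix x y assume xy: "x \<in> X" "y \<in> X" "a x = a y" "x \<noteq> y"
    define l where "l z = (if z = x then 1 else if z = y then -1 else 0 :: real)" for z
    have "(\<Sum>z\<in>X. l z *\<^sub>R a z) = (\<Sum>z\<in>{x, y}. l z *\<^sub>R a z)"
      using assms(1) xy by (intro sum.mono_neutral_right) (auto simp: l_def)
    also have "\<dots> = 0" using xy by (simp add: l_def)
    finally have "l x = 0" using vec_indepD[OF assms(2)] xy by blast
    then show False by (simp add: l_def)
  qed
  show "independent (a ` X)"
  proof
    assume "dependent (a ` X)"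
    then obtain u where u: "\<exists>v\<in>a ` X. u v \<noteq> 0" "(\<Sum>v\<in>a ` X. u v *\<^sub>R v) = 0"
      using assms(1) by (auto simp: dependent_finite)
    then have "(\<Sum>x\<in>X. u (a x) *\<^sub>R a x) = 0" by (simp add: sum.reindex[OF inj])
    then show False using u(1) vec_indepD[OF assms(2), of "\<lambda>x. u (a x)"] by blast
  qed
qed

lemma vec_indep_spans:
  fixes a :: "'w \<Rightarrow> real ^ 'd"
  assumes "finite X" "vec_indep X a" "card X = CARD('d)"
  shows "span (a ` X) = UNIV"
proof -
  have "UNIV \<subseteq> span (a ` X)"
    by (rule card_ge_dim_independent)
      (use vec_indep_inj_independent[OF assms(1,2)] assms(3) in \<open>auto simp: card_image\<close>)
  then show ?thesis by blast
qed

lemma vec_indep_orthogonal_eq_0: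
  fixes a :: "'w \<Rightarrow> real ^ 'd"
  assumes "finite X" "vec_indep X a" "card X = CARD('d)" "\<And>x. x \<in> X \<Longrightarrow> a x \<bullet> y = 0"
  shows "y = 0"
proof -
  have "y \<in> span (a ` X)" using vec_indep_spans[OF assms(1-3)] by simp
  then have "orthogonal y y"
    by (rule orthogonal_to_span) (use assms(4) in \<open>auto simp: orthogonal_def inner_commute\<close>)
  then show ?thesis by (simp add: orthogonal_self)
qed

text \<open>\<open>A\<close> is an infinitesimal rotation: the \<open>a x\<close> form a basis, so
  \<open>A\<close> is fixed by its values there, and skewness on basis pairs extends bilinearly. It
  is later subtracted from a motion to bring part of a framework to rest.\<close>

lemma skew_map_exists:
  fixes a b :: "'w \<Rightarrow> real ^ 'd"
  assumes "finite X" "vec_indep X a" "card X = CARD('d)"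
    and skew: "\<And>x y. x \<in> X \<Longrightarrow> y \<in> X \<Longrightarrow> a x \<bullet> b y + a y \<bullet> b x = 0"
  shows "\<exists>A. linear A \<and> (\<forall>x\<in>X. A (a x) = b x) \<and> (\<forall>u v. u \<bullet> A v = - (A u \<bullet> v))"
proof -
  note inj = vec_indep_inj_independent[OF assms(1,2)]
  obtain A where A: "linear A" "\<And>z. z \<in> a ` X \<Longrightarrow> A z = b (the_inv_into X a z)"
    using linear_independent_extend[OF inj(2), of "\<lambda>z. b (the_inv_into X a z)"] by blast
  have Aa: "A (a x) = b x" if "x \<in> X" for x
    using A(2) that by (simp add: the_inv_into_f_f[OF inj(1)])
  interpret A: linear A by (rule A(1))
  have span: "z \<in> span (a ` X)" for z using vec_indep_spans[OF assms(1-3)] by simp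
  have 1: "a x \<bullet> A v + A (a x) \<bullet> v = 0" if x: "x \<in> X" for x v
    using span[of v]
  proof (induction rule: span_induct_alt)
    case base then show ?case by (simp add: A.zero)
  next
    case (step c z y)
    then obtain x' where x': "x' \<in> X" "z = a x'" by blast
    have "a x \<bullet> A z + A (a x) \<bullet> z = 0"
      using skew[OF x x'(1)] x x' by (simp add: Aa inner_commute)
    then have "c * (a x \<bullet> A z + A (a x) \<bullet> z) = 0" by simp
    then show ?case using step.IH by (simp add: A.add A.scale inner_simps algebra_simps)
  qed
  have "u \<bullet> A v + A u \<bullet> v = 0" for u v
    using span[of u]
  proof (induction rule: span_induct_alt)
    case base then show ?case by (simp add: A.zero)
  next
    case (step c z y)
    then have "c * (z \<bullet> A v + A z \<bullet> v) = 0" using 1 by auto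
    then show ?case using step.IH by (simp add: A.add A.scale inner_simps algebra_simps)
  qed
  then have "u \<bullet> A v = - (A u \<bullet> v)" for u v by (simp add: eq_neg_iff_add_eq_0)
  then show ?thesis using A(1) Aa by blast
qed

section \<open>Rows of the rigidity matrix: span, rank and independence\<close>

definition fscale :: "real \<Rightarrow> ('a \<Rightarrow> real ^ 'd::finite) \<Rightarrow> 'a \<Rightarrow> real ^ 'd" where
  "fscale c f = (\<lambda>x. c *\<^sub>R f x)"

interpretation rows: vector_space "fscale :: real \<Rightarrow> ('a \<Rightarrow> real ^ 'd::finite) \<Rightarrow> 'a \<Rightarrow> real ^ 'd"
  by unfold_locales (auto simp: fscale_def fun_eq_iff algebra_simps)

interpretation rows_functional: vector_space_pair
  "fscale :: real \<Rightarrow> ('a \<Rightarrow> real ^ 'd::finite) \<Rightarrow> 'a \<Rightarrow> real ^ 'd" "(*) :: real \<Rightarrow> real \<Rightarrow> real"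
  by unfold_locales (auto simp: algebra_simps)

lemma sum_fscale_apply: "(\<Sum>e\<in>F. fscale (l e) (f e)) x = (\<Sum>e\<in>F. l e *\<^sub>R f e x)"
  by (induction F rule: infinite_finite_induct) (auto simp: fscale_def)

text \<open>The row of \<open>e\<close> in the rigidity matrix. For a pair \<open>e\<close> the
  summand at \<open>y = x\<close> is zero, so only the difference to the other endpoint remains and
  no orientation has to be chosen.\<close>

definition edge_row :: "('a \<Rightarrow> real ^ 'd::finite) \<Rightarrow> 'a set \<Rightarrow> 'a \<Rightarrow> real ^ 'd" where
  "edge_row p e x = (if x \<in> e then \<Sum>y\<in>e. p x - p y else 0)"

lemma edge_row_pair:
  "u \<noteq> v \<Longrightarrow> edge_row p {u, v} = (\<lambda>x. if x = u then p u - p v else if x = v then p v - p u else 0)"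
  by (auto simp: edge_row_def fun_eq_iff)

lemma edge_row_cong: "(\<And>x. x \<in> e \<Longrightarrow> p x = q x) \<Longrightarrow> edge_row p e = edge_row q e"
  by (auto simp: edge_row_def fun_eq_iff)

abbreviation edge_span :: "('a \<Rightarrow> real ^ 'd::finite) \<Rightarrow> 'a set set \<Rightarrow> ('a \<Rightarrow> real ^ 'd) set" where
  "edge_span p F \<equiv> rows.span (edge_row p ` F)"

definition edge_rank :: "('a \<Rightarrow> real ^ 'd::finite) \<Rightarrow> 'a set set \<Rightarrow> nat" where
  "edge_rank p F = rows.dim (edge_row p ` F)"

definition edge_indep :: "('a \<Rightarrow> real ^ 'd::finite) \<Rightarrow> 'a set set \<Rightarrow> bool" where
  "edge_indep p F \<longleftrightarrow> (\<forall>l. (\<forall>x. (\<Sum>e\<in>F. l e *\<^sub>R edge_row p e x) = 0) \<longrightarrow> (\<forall>e\<in>F. l e = 0))"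

lemma edge_indepD:
  "edge_indep p F \<Longrightarrow> (\<And>x. (\<Sum>e\<in>F. l e *\<^sub>R edge_row p e x) = 0) \<Longrightarrow> e \<in> F \<Longrightarrow> l e = 0"
  unfolding edge_indep_def by blast

lemma edge_indep_cong:
  assumes "\<And>e x. e \<in> F \<Longrightarrow> x \<in> e \<Longrightarrow> p x = q x"
  shows "edge_indep p F \<longleftrightarrow> edge_indep q F"
proof -
  have "(\<Sum>e\<in>F. l e *\<^sub>R edge_row p e x) = (\<Sum>e\<in>F. l e *\<^sub>R edge_row q e x)" for l x
    using assms by (intro sum.cong refl) (metis edge_row_cong)
  then show ?thesis by (simp add: edge_indep_def)
qed

lemma edge_indep_iff:
  assumes "finite F"
  shows "edge_indep p F \<longleftrightarrow> inj_on (edge_row p) F \<and> rows.independent (edge_row p ` F)"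
proof safe
  assume ind: "edge_indep p F"
  show inj: "inj_on (edge_row p) F"
  proof (rule inj_onI, rule ccontr)
    fix e f assume ef: "e \<in> F" "f \<in> F" "edge_row p e = edge_row p f" "e \<noteq> f"
    define l where "l z = (if z = e then 1 else if z = f then -1 else 0 :: real)" for z
    have "(\<Sum>z\<in>F. l z *\<^sub>R edge_row p z x) = 0" for x
    proof -
      have "(\<Sum>z\<in>F. l z *\<^sub>R edge_row p z x) = (\<Sum>z\<in>{e, f}. l z *\<^sub>R edge_row p z x)"
        using assms(1) ef by (intro sum.mono_neutral_right) (auto simp: l_def)
      also have "\<dots> = 0" using ef by (simp add: l_def)
      finally show ?thesis .
    qed
    then have "l e = 0" using edge_indepD[OF ind] ef by blast
    then show False by (simp add: l_def)
  qed
  assume "rows.dependent (edge_row p ` F)"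
  then obtain u where u: "\<exists>v\<in>edge_row p ` F. u v \<noteq> 0" "(\<Sum>v\<in>edge_row p ` F. fscale (u v) v) = 0"
    using assms(1) by (auto simp: rows.dependent_finite)
  have "(\<Sum>e\<in>F. u (edge_row p e) *\<^sub>R edge_row p e x) = 0" for x
    using fun_cong[OF u(2), of x] by (simp add: sum.reindex[OF inj] sum_fscale_apply)
  then show False using u(1) edge_indepD[OF ind, of "\<lambda>e. u (edge_row p e)"] by blast
next
  assume inj: "inj_on (edge_row p) F" and ind: "rows.independent (edge_row p ` F)"
  show "edge_indep p F"
    unfolding edge_indep_def
  proof (intro allI impI ballI)
    fix l e assume l: "\<forall>x. (\<Sum>e\<in>F. l e *\<^sub>R edge_row p e x) = 0" and e: "e \<in> F"
    define u where "u v = l (the_inv_into F (edge_row p) v)" for v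
    have u: "u (edge_row p f) = l f" if "f \<in> F" for f
      by (simp add: u_def the_inv_into_f_f[OF inj that])
    have "(\<Sum>v\<in>edge_row p ` F. fscale (u v) v) = (\<Sum>f\<in>F. fscale (l f) (edge_row p f))"
      by (simp add: sum.reindex[OF inj] u)
    also have "\<dots> = 0" using l by (simp add: fun_eq_iff sum_fscale_apply)
    finally have "u (edge_row p e) = 0"
      using rows.independentD[OF ind, of "edge_row p ` F" u "edge_row p e"] assms e by auto
    then show "l e = 0" using u e by simp
  qed
qed

lemma edge_indep_insert:
  assumes "finite F" "edge_indep p F" "e \<notin> F"
  shows "edge_indep p (insert e F) \<longleftrightarrow> edge_row p e \<notin> edge_span p F"
proof -
  have "edge_row p e \<in> edge_row p ` F \<Longrightarrow> edge_row p e \<in> edge_span p F" by (rule rows.span_base)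
  then show ?thesis
    using assms by (auto simp: edge_indep_iff rows.independent_insert)
qed

lemma edge_basis:
  assumes "finite F"
  obtains B where "B \<subseteq> F" "edge_indep p B" "card B = edge_rank p F" "edge_row p ` F \<subseteq> edge_span p B"
proof -
  obtain R where R: "R \<subseteq> edge_row p ` F" "rows.independent R" "edge_row p ` F \<subseteq> rows.span R"
    using rows.maximal_independent_subset by blast
  obtain B where B: "B \<subseteq> F" "inj_on (edge_row p) B" "R = edge_row p ` B"
    using R(1) subset_image_inj by metis
  have "card B = edge_rank p F"
    using rows.basis_card_eq_dim[OF R(1,3,2)] B by (simp add: edge_rank_def card_image)
  moreover have "edge_indep p B"
    using B R finite_subset[OF B(1) assms] by (simp add: edge_indep_iff)
  ultimately show ?thesis using that B R by blast
qed

lemma edge_rank_le_card: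
  assumes "finite B" "edge_row p ` F \<subseteq> edge_span p B"
  shows "edge_rank p F \<le> card B"
proof -
  have "edge_rank p F \<le> card (edge_row p ` B)"
    unfolding edge_rank_def by (rule rows.dim_le_card) (use assms in auto)
  also have "\<dots> \<le> card B" using assms(1) by (rule card_image_le)
  finally show ?thesis .
qed

lemma card_le_edge_rank:
  assumes "finite F" "B \<subseteq> F" "edge_indep p B"
  shows "card B \<le> edge_rank p F"
proof -
  obtain C where C: "C \<subseteq> F" "edge_indep p C" "card C = edge_rank p F" "edge_row p ` F \<subseteq> edge_span p C"
    using edge_basis[OF assms(1)] .
  have fin: "finite B" "finite C" using assms C finite_subset by blast+
  have "card (edge_row p ` B) \<le> card (edge_row p ` C)"
    using rows.independent_span_bound[of "edge_row p ` C" "edge_row p ` B"] assms C fin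
    by (auto simp: edge_indep_iff)
  then show ?thesis
    using assms C fin by (simp add: edge_indep_iff card_image)
qed

lemma edge_rank_mono:
  assumes "finite F" "F' \<subseteq> F"
  shows "edge_rank p F' \<le> edge_rank p F"
proof -
  obtain B where "B \<subseteq> F'" "edge_indep p B" "card B = edge_rank p F'" "edge_row p ` F' \<subseteq> edge_span p B"
    by (rule edge_basis[OF finite_subset[OF assms(2,1)]])
  then show ?thesis using card_le_edge_rank[OF assms(1), of B p] assms(2) by auto
qed

lemma edge_span_mono: "F \<subseteq> F' \<Longrightarrow> edge_span p F \<subseteq> edge_span p F'"
  by (intro rows.span_mono image_mono)

lemma edge_span_trans:
  assumes "f \<in> edge_span p F" "\<And>e. e \<in> F \<Longrightarrow> edge_row p e \<in> edge_span p F'"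
  shows "f \<in> edge_span p F'"
proof -
  have "edge_span p F \<subseteq> edge_span p F'"
    by (rule rows.span_minimal) (use assms(2) in \<open>auto intro: rows.subspace_span\<close>)
  then show ?thesis using assms(1) by blast
qed

lemma edge_span_base: "e \<in> F \<Longrightarrow> edge_row p e \<in> edge_span p F"
  by (intro rows.span_base imageI)

lemma edge_rank_eq_imp_span:
  assumes "finite F" "F' \<subseteq> F" "edge_rank p F \<le> edge_rank p F'" "e \<in> F"
  shows "edge_row p e \<in> edge_span p F'"
proof (rule ccontr)
  assume e: "edge_row p e \<notin> edge_span p F'"
  obtain B where B: "B \<subseteq> F'" "edge_indep p B" "card B = edge_rank p F'" "edge_row p ` F' \<subseteq> edge_span p B"
    by (rule edge_basis[OF finite_subset[OF assms(2,1)]])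
  have fin: "finite B" by (rule finite_subset[OF B(1) finite_subset[OF assms(2,1)]])
  have eB: "edge_row p e \<notin> edge_span p B" using e edge_span_mono[OF B(1)] by blast
  then have "e \<notin> B" using edge_span_base by blast
  then have "edge_indep p (insert e B)" "card (insert e B) = Suc (card B)"
    using edge_indep_insert[OF fin B(2)] eB fin by auto
  then show False
    using card_le_edge_rank[OF assms(1), of "insert e B" p] assms B by auto
qed

section \<open>Infinitesimal motions as functionals on the rows\<close>

lemma edge_row_pairing:
  assumes "finite V" "x \<in> V" "y \<in> V" "x \<noteq> y"
  shows "(\<Sum>z\<in>V. edge_row q {x, y} z \<bullet> h z) = (q x - q y) \<bullet> (h x - h y)"
proof -
  have "(\<Sum>z\<in>V. edge_row q {x, y} z \<bullet> h z) = (\<Sum>z\<in>{x, y}. edge_row q {x, y} z \<bullet> h z)"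
    using assms by (intro sum.mono_neutral_right) (auto simp: edge_row_pair)
  also have "\<dots> = (q x - q y) \<bullet> (h x - h y)" using assms by (simp add: edge_row_pair inner_simps)
  finally show ?thesis .
qed

text \<open>Pairing with \<open>h\<close> is linear in the row, so its vanishing on the rows of
  \<open>F\<close> carries over to their span.\<close>

lemma edge_span_motion:
  fixes q h :: "'a \<Rightarrow> real ^ 'd"
  assumes V: "finite V" and F: "\<And>e. e \<in> F \<Longrightarrow> \<exists>x\<in>V. \<exists>y\<in>V. x \<noteq> y \<and> e = {x, y} \<and> (q x - q y) \<bullet> (h x - h y) = 0"
    and uv: "u \<in> V" "v \<in> V" "edge_row q {u, v} \<in> edge_span q F"
  shows "(q u - q v) \<bullet> (h u - h v) = 0"
proof (cases "u = v")
  case False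
  define pair where "pair f = (\<Sum>x\<in>V. f x \<bullet> h x)" for f :: "'a \<Rightarrow> real ^ 'd"
  have pair_edge: "pair (edge_row q {x, y}) = (q x - q y) \<bullet> (h x - h y)" if "x \<in> V" "y \<in> V" "x \<noteq> y" for x y
    unfolding pair_def using V that by (rule edge_row_pairing)
  have "pair f = 0" if "f \<in> edge_span q F" for f
    using that
  proof (induction rule: rows.span_induct_alt)
    case base then show ?case by (simp add: pair_def)
  next
    case (step c g f)
    then obtain e where e: "e \<in> F" "g = edge_row q e" by blast
    obtain x y where xy: "x \<in> V" "y \<in> V" "x \<noteq> y" "e = {x, y}" "(q x - q y) \<bullet> (h x - h y) = 0"
      using F[OF e(1)] by blast
    have "pair g = 0" using e(2) xy pair_edge[OF xy(1-3)] by simp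
    moreover have "pair (fscale c g + f) = c * pair g + pair f"
      by (simp add: pair_def fscale_def inner_simps sum.distrib sum_distrib_left)
    ultimately show ?case using step.IH by (simp only: mult_zero_right add_0)
  qed
  then show ?thesis using pair_edge[OF uv(1,2) False] uv(3) by simp
qed simp

text \<open>Some linear functional vanishes on the rows of \<open>F\<close> but not on that of
  \<open>{u, v}\<close>. On functions supported at a single vertex \<open>x\<close> it is the inner
  product with a vector, and these vectors form the motion \<open>h\<close>.\<close>

lemma separating_motion:
  fixes p :: "'a \<Rightarrow> real ^ 'd"
  assumes "edge_row p {u, v} \<notin> edge_span p F" "u \<noteq> v"
  obtains h where "\<And>x y. x \<noteq> y \<Longrightarrow> {x, y} \<in> F \<Longrightarrow> (p x - p y) \<bullet> (h x - h y) = 0"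
    and "(p u - p v) \<bullet> (h u - h v) \<noteq> 0"
proof -
  obtain R where R: "R \<subseteq> edge_row p ` F" "rows.independent R" "edge_row p ` F \<subseteq> rows.span R"
    using rows.maximal_independent_subset by blast
  let ?f = "edge_row p {u, v}"
  have f: "?f \<notin> rows.span R" using assms(1) rows.span_mono[OF R(1)] by blast
  then have fR: "?f \<notin> R" using rows.span_base by blast
  have "rows.independent (insert ?f R)" using rows.independent_insertI[OF f R(2)] .
  from rows_functional.linear_independent_extend[OF this, of "\<lambda>g. if g = ?f then 1 else 0"]
  obtain \<phi> where \<phi>: "Vector_Spaces.linear fscale (*) \<phi>" "\<forall>g\<in>insert ?f R. \<phi> g = (if g = ?f then 1 else 0)"
    by blast
  interpret \<phi>: Vector_Spaces.linear fscale "(*)" \<phi> by (rule \<phi>(1))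
  have R0: "\<phi> g = 0" if "g \<in> rows.span R" for g
    using that
  proof (induction rule: rows.span_induct_alt)
    case base then show ?case by (rule \<phi>.zero)
  next
    case (step c g f)
    then have "\<phi> g = 0" using \<phi>(2) fR by auto
    then show ?case using step.IH by (simp only: \<phi>.add \<phi>.scale mult_zero_right add_0)
  qed
  define \<delta> where "\<delta> x a = (\<lambda>y. if y = x then a else 0)" for x :: 'a and a :: "real ^ 'd"
  define h where "h x = (\<Sum>b\<in>Basis. \<phi> (\<delta> x b) *\<^sub>R b)" for x
  have \<delta>h: "\<phi> (\<delta> x a) = a \<bullet> h x" for x a
  proof -
    have "linear (\<lambda>a. \<phi> (\<delta> x a))"
    proof (rule linearI)
      fix a b show "\<phi> (\<delta> x (a + b)) = \<phi> (\<delta> x a) + \<phi> (\<delta> x b)"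
        unfolding \<phi>.add[symmetric] by (rule arg_cong[of _ _ \<phi>]) (auto simp: \<delta>_def fun_eq_iff)
    next
      fix c a
      have "\<delta> x (c *\<^sub>R a) = fscale c (\<delta> x a)" by (auto simp: \<delta>_def fscale_def fun_eq_iff)
      then show "\<phi> (\<delta> x (c *\<^sub>R a)) = c *\<^sub>R \<phi> (\<delta> x a)" by (simp add: \<phi>.scale)
    qed
    then interpret L: linear "\<lambda>a. \<phi> (\<delta> x a)" .
    have "\<phi> (\<delta> x a) = \<phi> (\<delta> x (\<Sum>b\<in>Basis. (a \<bullet> b) *\<^sub>R b))" by (simp only: euclidean_representation)
    also have "\<dots> = (\<Sum>b\<in>Basis. (a \<bullet> b) * \<phi> (\<delta> x b))" by (simp add: L.sum L.scale)
    also have "\<dots> = a \<bullet> h x" by (simp add: h_def inner_sum_right mult.commute)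
    finally show ?thesis .
  qed
  have edge: "\<phi> (edge_row p {x, y}) = (p x - p y) \<bullet> (h x - h y)" if "x \<noteq> y" for x y
  proof -
    have "edge_row p {x, y} = \<delta> x (p x - p y) + \<delta> y (p y - p x)"
      using that by (auto simp: edge_row_pair \<delta>_def fun_eq_iff)
    then have "\<phi> (edge_row p {x, y}) = (p x - p y) \<bullet> h x + (p y - p x) \<bullet> h y"
      by (simp only: \<phi>.add \<delta>h)
    then show ?thesis by (simp add: inner_simps)
  qed
  show ?thesis
  proof (rule that[of h])
    fix x y assume xy: "x \<noteq> y" "{x, y} \<in> F"
    then have "edge_row p {x, y} \<in> rows.span R" using R(3) by blast
    then show "(p x - p y) \<bullet> (h x - h y) = 0" using R0 edge[OF xy(1)] by simp
  next
    show "(p u - p v) \<bullet> (h u - h v) \<noteq> 0"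
      using \<phi>(2) edge[OF assms(2)] by simp
  qed
qed

definition vertex_pairs :: "'a set \<Rightarrow> 'a set set" where
  "vertex_pairs V = {e. e \<subseteq> V \<and> card e = 2}"

lemma vertex_pairs_iff: "e \<in> vertex_pairs V \<longleftrightarrow> (\<exists>x\<in>V. \<exists>y\<in>V. x \<noteq> y \<and> e = {x, y})"
  by (auto simp: vertex_pairs_def card_2_iff)

lemma doubleton_in_vertex_pairs: "{x, y} \<in> vertex_pairs V \<longleftrightarrow> x \<in> V \<and> y \<in> V \<and> x \<noteq> y"
  by (auto simp: vertex_pairs_def card_2_iff)

lemma finite_vertex_pairs: "finite V \<Longrightarrow> finite (vertex_pairs V)"
  by (rule finite_subset[of _ "Pow V"]) (auto simp: vertex_pairs_def)

section \<open>Transfer of independence and spans between placements\<close>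

definition placement_coords :: "('a \<Rightarrow> real ^ 'd::finite) \<Rightarrow> 'a \<times> 'd \<Rightarrow> real" where
  "placement_coords p = (\<lambda>(v, i). p v $ i)"

definition coord_row :: "('a \<times> 'd::finite \<Rightarrow> real) \<Rightarrow> 'a set \<Rightarrow> 'a \<times> 'd \<Rightarrow> real" where
  "coord_row c e = (\<lambda>(x, i). if x \<in> e then \<Sum>y\<in>e. c (x, i) - c (y, i) else 0)"

lemma edge_indep_iff_indep_family:
  "edge_indep p F \<longleftrightarrow> indep_family F UNIV (coord_row (placement_coords p))"
proof -
  have row: "coord_row (placement_coords p) e (x, i) = edge_row p e x $ i" for e x i
    by (simp add: coord_row_def placement_coords_def edge_row_def)
  show ?thesis
    unfolding edge_indep_def indep_family_def by (simp add: vec_eq_iff row)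
qed

lemma rat_polyfun_coord_row:
  assumes "e \<subseteq> V"
  shows "rat_polyfun (V \<times> UNIV) (\<lambda>c. coord_row c e k)"
proof (cases k)
  case (Pair x i)
  show ?thesis
    unfolding Pair coord_row_def prod.case using assms
    by (cases "x \<in> e")
      (auto intro!: rat_polyfun_zero rat_polyfun_sum rat_polyfun_diff rat_polyfun_coord)
qed

lemma generic_placement_mono: "generic_placement V p \<Longrightarrow> W \<subseteq> V \<Longrightarrow> generic_placement W p"
  unfolding generic_placement_def by (erule alg_independent_over_rat_mono) auto

lemma generic_placement_exists:
  assumes "finite V"
  shows "\<exists>p :: 'a \<Rightarrow> real ^ 'd. generic_placement V p"
proof -
  obtain c :: "'a \<times> 'd \<Rightarrow> real" where c: "alg_independent_over_rat (V \<times> UNIV) c"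
    using alg_independent_exists[of "V \<times> (UNIV :: 'd set)"] assms by auto
  then have "generic_placement V (\<lambda>v. \<chi> i. c (v, i))"
    unfolding generic_placement_def by (simp add: case_prod_unfold)
  then show ?thesis by blast
qed

text \<open>Independence at one placement, however special, is witnessed by a polynomial that cannot
  vanish at the generic one. Extensions can therefore be checked in convenient positions.\<close>

lemma edge_indep_generic:
  fixes p q :: "'a \<Rightarrow> real ^ 'd"
  assumes "generic_placement V p" "finite F" "\<And>e. e \<in> F \<Longrightarrow> e \<subseteq> V" "edge_indep q F"
  shows "edge_indep p F"
  unfolding edge_indep_iff_indep_family
proof (rule indep_family_generic[of F UNIV "V \<times> UNIV" coord_row "placement_coords q" "placement_coords p"])
  show "indep_family F UNIV (coord_row (placement_coords q))"
    using assms(4) by (simp only: edge_indep_iff_indep_family)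
  show "alg_independent_over_rat (V \<times> UNIV) (placement_coords p)"
    using assms(1) by (simp add: generic_placement_def placement_coords_def)
qed (use assms in \<open>auto intro: rat_polyfun_coord_row\<close>)

text \<open>The polynomial witness of independence is continuous and nonzero at \<open>p\<close>,
  hence nonzero nearby.\<close>

lemma edge_indep_open:
  assumes "finite F" "\<And>e. e \<in> F \<Longrightarrow> e \<subseteq> V" "edge_indep p F"
  shows "\<exists>\<epsilon>>0. \<forall>q. (\<forall>v\<in>V. norm (p v - q v) < \<epsilon>) \<longrightarrow> edge_indep q F"
proof (rule ccontr)
  have "\<exists>\<delta>. rat_polyfun (V \<times> UNIV) \<delta> \<and> \<delta> (placement_coords p) \<noteq> 0 \<and>
      (\<forall>c. \<delta> c \<noteq> 0 \<longrightarrow> indep_family F UNIV (coord_row c))"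
    by (rule indep_family_witness[of F UNIV "V \<times> UNIV" coord_row "placement_coords p"])
      (use assms in \<open>auto simp: edge_indep_iff_indep_family intro: rat_polyfun_coord_row\<close>)
  then obtain \<delta> where \<delta>: "rat_polyfun (V \<times> UNIV) \<delta>" "\<delta> (placement_coords p) \<noteq> 0"
    "\<And>c. \<delta> c \<noteq> 0 \<Longrightarrow> indep_family F UNIV (coord_row c)" by blast
  assume neg: "\<not> ?thesis"
  have "\<exists>q. (\<forall>v\<in>V. norm (p v - q v) < inverse (real (Suc n))) \<and> \<not> edge_indep q F" for n
  proof -
    have "inverse (real (Suc n)) > 0" by simp
    then show ?thesis using neg by blast
  qed
  then obtain q where q: "\<And>n v. v \<in> V \<Longrightarrow> norm (p v - q n v) < inverse (real (Suc n))"
    "\<And>n. \<not> edge_indep (q n) F" by metis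
  have "(\<lambda>n. placement_coords (q n) k) \<longlonglongrightarrow> placement_coords p k" if k: "k \<in> V \<times> UNIV" for k
  proof -
    obtain v i where vi: "k = (v, i)" "v \<in> V" using k by blast
    have "(\<lambda>n. q n v) \<longlonglongrightarrow> p v"
    proof (rule LIMSEQ_norm_0[of "\<lambda>n. q n v - p v", THEN LIM_zero_cancel])
      fix n show "norm (q n v - p v) < 1 / real (Suc n)"
        using q(1)[OF vi(2), of n] by (simp add: norm_minus_commute divide_inverse)
    qed
    then show ?thesis unfolding vi placement_coords_def by (simp add: tendsto_vec_nth)
  qed
  then have "(\<lambda>n. \<delta> (placement_coords (q n))) \<longlonglongrightarrow> \<delta> (placement_coords p)"
    by (rule rat_polyfun_tendsto[OF \<delta>(1)])
  from tendsto_imp_eventually_ne[OF this \<delta>(2)] obtain n where "\<delta> (placement_coords (q n)) \<noteq> 0"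
    by (auto simp: eventually_sequentially)
  then show False using \<delta>(3) q(2) by (auto simp: edge_indep_iff_indep_family)
qed

text \<open>If the span relation failed at \<open>q\<close>, then \<open>insert e B\<close> would be
  independent at \<open>q\<close> and so at the generic \<open>p\<close>. Only independence of
  \<open>B\<close> is asked of \<open>q\<close>, which may otherwise be special.\<close>

lemma edge_span_transfer:
  fixes p q :: "'a \<Rightarrow> real ^ 'd"
  assumes "generic_placement V p" "finite B" "\<And>f. f \<in> B \<Longrightarrow> f \<subseteq> V" "e \<subseteq> V"
    and "edge_indep q B" "edge_row p e \<in> edge_span p B"
  shows "edge_row q e \<in> edge_span q B"
proof (cases "e \<in> B")
  case False
  show ?thesis
  proof (rule ccontr)
    assume "edge_row q e \<notin> edge_span q B"
    then have "edge_indep q (insert e B)" using assms False by (simp add: edge_indep_insert)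
    then have "edge_indep p (insert e B)" using assms by (intro edge_indep_generic[OF assms(1), where q = q]) auto
    moreover have "edge_indep p B" using assms by (intro edge_indep_generic[OF assms(1), where q = q]) auto
    ultimately show False using assms False by (simp add: edge_indep_insert)
  qed
qed (rule edge_span_base)

lemma generic_vec_indep:
  fixes p :: "'a \<Rightarrow> real ^ 'd"
  assumes "generic_placement V p" "finite X" "X \<subseteq> V" "v \<in> V" "v \<notin> X" "card X \<le> CARD('d)"
  shows "vec_indep X (\<lambda>x. p x - p v)"
proof -
  obtain f :: "'a \<Rightarrow> 'd" where f: "inj_on f X"
    using card_le_inj[of X "UNIV :: 'd set"] assms(2,6) by auto
  define r where "r c x i = c (x, i) - c (v, i)" for c :: "'a \<times> 'd \<Rightarrow> real" and x i
  \<comment> \<open>The special position for the polynomial argument: \<open>v\<close> at the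
    origin, the points of \<open>X\<close> at distinct unit vectors.\<close>
  define c0 where "c0 = (\<lambda>(x, i). if x \<in> X \<and> i = f x then 1 else 0 :: real)"
  have "indep_family X UNIV (r (placement_coords p))"
  proof (rule indep_family_generic[where I = "V \<times> UNIV" and q = c0])
    show "rat_polyfun (V \<times> UNIV) (\<lambda>c. r c e k)" if "e \<in> X" for e k
      unfolding r_def using that assms by (intro rat_polyfun_diff rat_polyfun_coord) auto
    show "indep_family X UNIV (r c0)"
      unfolding indep_family_def
    proof (intro allI impI ballI)
      fix l x assume l: "\<forall>k\<in>UNIV. (\<Sum>e\<in>X. l e * r c0 e k) = 0" and x: "x \<in> X"
      have "(\<Sum>e\<in>X. l e * r c0 e (f x)) = (\<Sum>e\<in>X. if e = x then l e else 0)"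
        using x assms(5) inj_onD[OF f] by (intro sum.cong refl) (auto simp: r_def c0_def)
      then show "l x = 0" using l x assms(2) by simp
    qed
  qed (use assms in \<open>auto simp: generic_placement_def placement_coords_def\<close>)
  then show ?thesis
    unfolding vec_indep_def indep_family_def
    by (simp add: vec_eq_iff r_def placement_coords_def)
qed

section \<open>Gluing, the rank of complete graphs, and vertex extensions\<close>

text \<open>\<open>F\<close> contains a complete graph on d + 2 vertices up to the pair
  \<open>{v, w}\<close>. A motion agrees on \<open>insert w U\<close> with an infinitesimal
  isometry; relative to it the velocity of \<open>v\<close> is orthogonal to the d independent
  vectors \<open>p u - p v\<close>, hence zero.\<close>

lemma glue_vertex:
  fixes p :: "'a \<Rightarrow> real ^ 'd"
  assumes gen: "generic_placement V p" and U: "U \<subseteq> V" "finite U" "card U = CARD('d)"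
    and vw: "v \<in> V" "w \<in> V" "v \<notin> U" "w \<notin> U" "v \<noteq> w"
    and F: "vertex_pairs (insert w U) \<subseteq> F" "\<And>u. u \<in> U \<Longrightarrow> {v, u} \<in> F"
  shows "edge_row p {v, w} \<in> edge_span p F"
proof (rule ccontr)
  assume "edge_row p {v, w} \<notin> edge_span p F"
  then obtain h where h: "\<And>x y. x \<noteq> y \<Longrightarrow> {x, y} \<in> F \<Longrightarrow> (p x - p y) \<bullet> (h x - h y) = 0"
    and hvw: "(p v - p w) \<bullet> (h v - h w) \<noteq> 0"
    using separating_motion vw(5) by metis
  have hU: "(p x - p y) \<bullet> (h x - h y) = 0" if "x \<in> insert w U" "y \<in> insert w U" for x y
    using h[of x y] F(1) that by (cases "x = y") (auto simp: doubleton_in_vertex_pairs subset_iff)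
  have indep: "vec_indep U (\<lambda>x. p x - p w)"
    by (rule generic_vec_indep[OF gen]) (use U vw in auto)
  have skew: "(p x - p w) \<bullet> (h y - h w) + (p y - p w) \<bullet> (h x - h w) = 0" if "x \<in> U" "y \<in> U" for x y
    using hU[of x y] hU[of x w] hU[of y w] that by (simp add: inner_simps algebra_simps)
  obtain A where A: "linear A" "\<And>x. x \<in> U \<Longrightarrow> A (p x - p w) = h x - h w" "\<And>u v. u \<bullet> A v = - (A u \<bullet> v)"
    using skew_map_exists[OF U(2) indep U(3) skew] by blast
  interpret A: linear A by (rule A(1))
  have self: "u \<bullet> A u = 0" for u using A(3)[of u u] by (simp add: inner_commute)
  define y where "y = h v - h w - A (p v - p w)"
  have "(p u - p v) \<bullet> y = 0" if u: "u \<in> U" for u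
  proof -
    have "h v - h u = y + A (p v - p w) - A (p u - p w)" using A(2)[OF u] by (simp add: y_def)
    also have "\<dots> = y + A (p v - p u)" by (simp add: A.diff)
    finally have "(p v - p u) \<bullet> (h v - h u) = (p v - p u) \<bullet> y" using self by (simp add: inner_add_right)
    moreover have "(p v - p u) \<bullet> (h v - h u) = 0" using h F(2)[OF u] u vw by metis
    ultimately show ?thesis by (simp add: inner_simps)
  qed
  moreover have "vec_indep U (\<lambda>x. p x - p v)"
    by (rule generic_vec_indep[OF gen]) (use U vw in auto)
  ultimately have "y = 0" using vec_indep_orthogonal_eq_0[OF U(2) _ U(3)] by blast
  then have "h v - h w = A (p v - p w)" by (simp add: y_def)
  then show False using hvw self by simp
qed

text \<open>The bound d n - d(d+1)/2, doubled to stay in the naturals. For d vertices it counts all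
  pairs; a further vertex adds at most d, since its edges to d old vertices span its other edges by
  \<open>glue_vertex\<close>.\<close>

lemma edge_rank_complete_le:
  fixes p :: "'a \<Rightarrow> real ^ 'd"
  assumes gen: "generic_placement V p" and "finite S" "S \<subseteq> V" "CARD('d) \<le> card S"
  shows "2 * edge_rank p (vertex_pairs S) + CARD('d) * (CARD('d) + 1) \<le> 2 * CARD('d) * card S"
  using assms(2-)
proof (induction "card S" arbitrary: S rule: less_induct)
  case less
  show ?case
  proof (cases "card S = CARD('d)")
    case True
    have "edge_rank p (vertex_pairs S) \<le> card (vertex_pairs S)"
      using less.prems finite_vertex_pairs by (intro edge_rank_le_card) (auto intro: rows.span_base)
    also have "\<dots> = card S choose 2"
      unfolding vertex_pairs_def using n_subsets[OF less.prems(1), of 2] by simp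
    finally have "2 * edge_rank p (vertex_pairs S) \<le> card S * (card S - 1)"
      by (simp add: choose_two)
    moreover have "card S * (card S - 1) + CARD('d) * (CARD('d) + 1) = 2 * CARD('d) * card S"
      unfolding True by (cases "CARD('d)") (simp_all add: algebra_simps)
    ultimately show ?thesis by linarith
  next
    case False
    then have lt: "CARD('d) < card S" using less.prems by simp
    then obtain v where v: "v \<in> S" by fastforce
    let ?T = "S - {v}"
    have T: "card S = Suc (card ?T)" "finite ?T" "CARD('d) \<le> card ?T"
      using v less.prems lt card_Suc_Diff1[of S v] by auto
    have IH: "2 * edge_rank p (vertex_pairs ?T) + CARD('d) * (CARD('d) + 1) \<le> 2 * CARD('d) * card ?T"
      using T less.prems by (intro less.hyps) auto
    obtain U where U: "U \<subseteq> ?T" "card U = CARD('d)" "finite U"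
      using obtain_subset_with_card_n[OF T(3)] by blast
    obtain B where B: "B \<subseteq> vertex_pairs ?T" "edge_indep p B" "card B = edge_rank p (vertex_pairs ?T)"
      "edge_row p ` vertex_pairs ?T \<subseteq> edge_span p B"
      using edge_basis[OF finite_vertex_pairs[OF T(2)]] .
    let ?N = "(\<lambda>u. {v, u}) ` U"
    have finB: "finite B" using B(1) finite_vertex_pairs[OF T(2)] finite_subset by blast
    have inB: "edge_row p e \<in> edge_span p (B \<union> ?N)" if "e \<in> vertex_pairs ?T \<union> ?N" for e
      using that B(4) edge_span_mono[of B "B \<union> ?N" p] edge_span_base[of e "B \<union> ?N" p] by blast
    have "edge_row p e \<in> edge_span p (B \<union> ?N)" if e: "e \<in> vertex_pairs S" for e
    proof (cases "v \<in> e")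
      case False
      then show ?thesis using inB e by (auto simp: vertex_pairs_def)
    next
      case True
      then obtain w where w: "e = {v, w}" "w \<in> ?T" using e by (auto simp: vertex_pairs_iff doubleton_eq_iff)
      show ?thesis
      proof (cases "w \<in> U")
        case False
        have "edge_row p {v, w} \<in> edge_span p (vertex_pairs ?T \<union> ?N)"
        proof (rule glue_vertex[OF gen _ U(3,2)])
          show "vertex_pairs (insert w U) \<subseteq> vertex_pairs ?T \<union> ?N"
            using U(1) w(2) by (auto simp: vertex_pairs_def)
        qed (use U w v less.prems False in auto)
        then show ?thesis unfolding w(1) by (rule edge_span_trans) (rule inB)
      qed (use inB w in auto)
    qed
    then have "edge_rank p (vertex_pairs S) \<le> card (B \<union> ?N)"
      using finB U by (intro edge_rank_le_card) auto
    also have "\<dots> \<le> card B + card ?N" by (rule card_Un_le)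
    also have "\<dots> \<le> card B + CARD('d)" using card_image_le[OF U(3), of "\<lambda>u. {v, u}"] U(2) by simp
    finally have "edge_rank p (vertex_pairs S) \<le> edge_rank p (vertex_pairs ?T) + CARD('d)" using B(3) by simp
    then show ?thesis using IH unfolding T(1) by (simp add: algebra_simps)
  qed
qed

text \<open>The 0-extension: at \<open>v\<close> a dependency involves only the new edges, whose
  vectors there are independent, so a dependency of \<open>B\<close> remains.\<close>

lemma edge_indep_add_vertex:
  fixes q :: "'a \<Rightarrow> real ^ 'd"
  assumes "finite B" "edge_indep q B" "\<And>e. e \<in> B \<Longrightarrow> v \<notin> e"
    and "finite X" "v \<notin> X" "vec_indep X (\<lambda>x. q x - q v)"
  shows "edge_indep q (B \<union> (\<lambda>x. {v, x}) ` X)"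
  unfolding edge_indep_def
proof (intro allI impI)
  fix l assume l: "\<forall>z. (\<Sum>e\<in>B \<union> (\<lambda>x. {v, x}) ` X. l e *\<^sub>R edge_row q e z) = 0"
  have inj: "inj_on (\<lambda>x. {v, x}) X" by (auto simp: inj_on_def doubleton_eq_iff)
  have split: "(\<Sum>e\<in>B. l e *\<^sub>R edge_row q e z) + (\<Sum>x\<in>X. l {v, x} *\<^sub>R edge_row q {v, x} z) = 0" for z
  proof -
    have "(\<Sum>e\<in>B \<union> (\<lambda>x. {v, x}) ` X. l e *\<^sub>R edge_row q e z) =
        (\<Sum>e\<in>B. l e *\<^sub>R edge_row q e z) + (\<Sum>e\<in>(\<lambda>x. {v, x}) ` X. l e *\<^sub>R edge_row q e z)"
      using assms by (intro sum.union_disjoint) auto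
    then show ?thesis using l by (simp add: sum.reindex[OF inj])
  qed
  have "(\<Sum>e\<in>B. l e *\<^sub>R edge_row q e v) = 0"
    using assms(3) by (intro sum.neutral) (auto simp: edge_row_def)
  then have "(\<Sum>x\<in>X. l {v, x} *\<^sub>R edge_row q {v, x} v) = 0" using split[of v] by simp
  moreover have "(\<Sum>x\<in>X. l {v, x} *\<^sub>R edge_row q {v, x} v) = - (\<Sum>x\<in>X. l {v, x} *\<^sub>R (q x - q v))"
    unfolding sum_negf[symmetric] using assms(5)
  proof (intro sum.cong refl)
    fix x assume "x \<in> X"
    then have "v \<noteq> x" using assms(5) by blast
    then show "l {v, x} *\<^sub>R edge_row q {v, x} v = - (l {v, x} *\<^sub>R (q x - q v))"
      by (simp add: edge_row_pair algebra_simps)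
  qed
  ultimately have X: "\<forall>x\<in>X. l {v, x} = 0"
    using vec_indepD[OF assms(6), of "\<lambda>x. l {v, x}"] by simp
  then have "(\<Sum>e\<in>B. l e *\<^sub>R edge_row q e z) = 0" for z using split[of z] by simp
  then have "\<forall>e\<in>B. l e = 0" using edge_indepD[OF assms(2)] by blast
  then show "\<forall>e\<in>B \<union> (\<lambda>x. {v, x}) ` X. l e = 0" using X by blast
qed

text \<open>The 1-extension: with \<open>v\<close> at the midpoint of \<open>w0 w1\<close>, the rows of \<open>v w0\<close> and \<open>v w1\<close> add up
  to half the row of \<open>w0 w1\<close>.\<close>

lemma edge_indep_one_extension:
  fixes p :: "'a \<Rightarrow> real ^ 'd"
  assumes gen: "generic_placement V p"
    and B: "finite B" "\<And>e. e \<in> B \<Longrightarrow> e \<subseteq> V - {v}"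
    and X: "finite X" "X \<subseteq> V - {v}" "card X = CARD('d) + 1" "w0 \<in> X" "w1 \<in> X" "w0 \<noteq> w1" and v: "v \<in> V"
    and ind: "{w0, w1} \<notin> B" "edge_indep p (insert {w0, w1} B)"
  shows "edge_indep p (B \<union> (\<lambda>x. {v, x}) ` X)"
proof (rule edge_indep_generic[OF gen])
  define q where "q = p(v := (1/2) *\<^sub>R (p w0 + p w1))"
  have qv: "q v = (1/2) *\<^sub>R (p w0 + p w1)" and q: "\<And>x. x \<noteq> v \<Longrightarrow> q x = p x"
    by (auto simp: q_def)
  have vX: "v \<notin> X" "v \<noteq> w0" "v \<noteq> w1" using X by auto
  have ind_q: "edge_indep q (insert {w0, w1} B)"
    using ind(2) B(2) vX by (subst edge_indep_cong[of _ q p]) (auto simp: q_def)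
  define Y where "Y = X - {w0}"
  define U where "U = X - {w0, w1}"
  have YU: "Y = insert w1 U" "X = insert w0 (insert w1 U)" "w1 \<notin> U" "w0 \<notin> U" "finite U" "finite Y"
    using X by (auto simp: Y_def U_def)
  have "vec_indep Y (\<lambda>x. p x - p w0)"
    by (rule generic_vec_indep[OF gen]) (use X in \<open>auto simp: Y_def card_Diff_singleton\<close>)
  note indY = vec_indepD[OF this]
  have inj: "inj_on (\<lambda>x. {v, x}) X" by (auto simp: inj_on_def doubleton_eq_iff)
  have half: "edge_row q {v, w0} z + edge_row q {v, w1} z = (1/2) *\<^sub>R edge_row q {w0, w1} z" for z
    using vX X(6) by (auto simp: edge_row_pair q qv algebra_simps vec_eq_iff)
  show "edge_indep q (B \<union> (\<lambda>x. {v, x}) ` X)"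
    unfolding edge_indep_def
  proof (intro allI impI)
    fix l assume l: "\<forall>z. (\<Sum>e\<in>B \<union> (\<lambda>x. {v, x}) ` X. l e *\<^sub>R edge_row q e z) = 0"
    have split: "(\<Sum>e\<in>B. l e *\<^sub>R edge_row q e z) + (\<Sum>x\<in>X. l {v, x} *\<^sub>R edge_row q {v, x} z) = 0" for z
    proof -
      have "(\<Sum>e\<in>B \<union> (\<lambda>x. {v, x}) ` X. l e *\<^sub>R edge_row q e z) =
          (\<Sum>e\<in>B. l e *\<^sub>R edge_row q e z) + (\<Sum>e\<in>(\<lambda>x. {v, x}) ` X. l e *\<^sub>R edge_row q e z)"
        using B X by (intro sum.union_disjoint) auto
      then show ?thesis using l by (simp add: sum.reindex[OF inj])
    qed
    have "(\<Sum>e\<in>B. l e *\<^sub>R edge_row q e v) = 0"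
      using B(2) by (intro sum.neutral) (auto simp: edge_row_def)
    then have "(\<Sum>x\<in>X. l {v, x} *\<^sub>R edge_row q {v, x} v) = 0" using split[of v] by simp
    moreover have "edge_row q {v, x} v = (1/2) *\<^sub>R (p w1 - p w0) - (p x - p w0)" if x: "x \<in> X" for x
    proof -
      have "v \<noteq> x" using x vX by blast
      then show ?thesis by (auto simp: edge_row_pair q qv vec_eq_iff field_simps)
    qed
    ultimately have "(\<Sum>x\<in>X. l {v, x} *\<^sub>R ((1/2) *\<^sub>R (p w1 - p w0) - (p x - p w0))) = 0" by simp
    then have "((1/2) * (\<Sum>x\<in>X. l {v, x})) *\<^sub>R (p w1 - p w0) - (\<Sum>x\<in>X. l {v, x} *\<^sub>R (p x - p w0)) = 0"
      by (simp add: scaleR_diff_right sum_subtractf sum_divide_distrib scaleR_sum_left)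
    moreover have "(\<Sum>x\<in>X. l {v, x} *\<^sub>R (p x - p w0)) = (\<Sum>x\<in>Y. l {v, x} *\<^sub>R (p x - p w0))"
      using YU X by simp
    \<comment> \<open>The coefficients of the relation at \<open>v\<close> in the independent
      vectors \<open>p x - p w0\<close>, \<open>x\<close> in \<open>Y\<close>. Their vanishing kills
      \<open>l\<close> on the edges to \<open>U\<close> and equates it on those to \<open>w0\<close>
      and \<open>w1\<close>.\<close>
    moreover define m where "m x = (if x = w1 then (1/2) * (\<Sum>x\<in>X. l {v, x}) else 0) - l {v, x}" for x
    moreover have "(\<Sum>x\<in>Y. m x *\<^sub>R (p x - p w0)) =
        ((1/2) * (\<Sum>x\<in>X. l {v, x})) *\<^sub>R (p w1 - p w0) - (\<Sum>x\<in>Y. l {v, x} *\<^sub>R (p x - p w0))"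
    proof -
      have "(\<Sum>x\<in>Y. m x *\<^sub>R (p x - p w0)) =
        (\<Sum>x\<in>Y. if x = w1 then ((1/2) * (\<Sum>x\<in>X. l {v, x})) *\<^sub>R (p x - p w0) else 0) -
        (\<Sum>x\<in>Y. l {v, x} *\<^sub>R (p x - p w0))"
        unfolding sum_subtractf[symmetric]
        by (intro sum.cong refl) (auto simp: m_def scaleR_diff_left)
      then show ?thesis using YU by simp
    qed
    ultimately have m0: "m x = 0" if "x \<in> Y" for x using indY[of m x] that by simp
    have lU: "l {v, x} = 0" if "x \<in> U" for x
      using m0[of x] that YU by (auto simp: m_def split: if_splits)
    have "l {v, w1} = (1/2) * (\<Sum>x\<in>X. l {v, x})" using m0[of w1] YU by (simp add: m_def)
    moreover have "(\<Sum>x\<in>X. l {v, x}) = l {v, w0} + l {v, w1}"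
      using YU lU X(6) by simp
    ultimately have l01: "l {v, w0} = l {v, w1}" by simp
    \<comment> \<open>The star now contributes a multiple of the row of \<open>{w0, w1}\<close>,
      which leaves a dependency of \<open>insert {w0, w1} B\<close>.\<close>
    have final: "(\<Sum>e\<in>B. l e *\<^sub>R edge_row q e z) + (l {v, w1} / 2) *\<^sub>R edge_row q {w0, w1} z = 0" for z
    proof -
      have "(\<Sum>x\<in>X. l {v, x} *\<^sub>R edge_row q {v, x} z) =
          l {v, w1} *\<^sub>R (edge_row q {v, w0} z + edge_row q {v, w1} z)"
        using YU lU X(6) l01 by (simp add: scaleR_add_right)
      then show ?thesis using split[of z] unfolding half by simp
    qed
    define n where "n e = (if e = {w0, w1} then l {v, w1} / 2 else l e)" for e
    have "(\<Sum>e\<in>insert {w0, w1} B. n e *\<^sub>R edge_row q e z) = 0" for z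
    proof -
      have "(\<Sum>e\<in>B. n e *\<^sub>R edge_row q e z) = (\<Sum>e\<in>B. l e *\<^sub>R edge_row q e z)"
        using ind(1) by (intro sum.cong refl) (auto simp: n_def)
      then show ?thesis using final[of z] B(1) ind(1) by (simp add: n_def add.commute)
    qed
    then have n0: "n e = 0" if "e \<in> insert {w0, w1} B" for e using edge_indepD[OF ind_q] that by blast
    have "l {v, w1} = 0" using n0[of "{w0, w1}"] by (simp add: n_def)
    moreover have "l e = 0" if "e \<in> B" for e using n0[of e] that ind(1) by (auto simp: n_def split: if_splits)
    ultimately show "\<forall>e\<in>B \<union> (\<lambda>x. {v, x}) ` X. l e = 0" using lU l01 YU by auto
  qed
qed (use B X v in auto)

section \<open>Local rigidity\<close>

text \<open>The averaging identity \<open>mh\<close> is exact, so no limit is taken. Near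
  \<open>p\<close> the basis \<open>B\<close> stays independent, hence by
  \<open>edge_span_transfer\<close> it still spans all pairs at the average placement.\<close>

lemma rigid_framework_if_spanning:
  fixes p :: "'a \<Rightarrow> real ^ 'd"
  assumes gen: "generic_placement V p" and V: "finite V" and E: "E \<subseteq> vertex_pairs V"
    and span: "\<And>e. e \<in> vertex_pairs V \<Longrightarrow> edge_row p e \<in> edge_span p E"
  shows "rigid_framework V E p"
proof -
  have finE: "finite E" by (rule finite_subset[OF E finite_vertex_pairs[OF V]])
  obtain B where B: "B \<subseteq> E" "edge_indep p B" "card B = edge_rank p E" "edge_row p ` E \<subseteq> edge_span p B"
    by (rule edge_basis[OF finE])
  have finB: "finite B" by (rule finite_subset[OF B(1) finE])
  have BV: "e \<subseteq> V" if "e \<in> B" for e using that B(1) E by (auto simp: vertex_pairs_def)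
  obtain \<epsilon> where \<epsilon>: "\<epsilon> > 0" "\<And>m. (\<forall>v\<in>V. norm (p v - m v) < \<epsilon>) \<Longrightarrow> edge_indep m B"
    using edge_indep_open[OF finB BV B(2)] by blast
  have "same_distances V p q"
    if q: "same_edge_lengths E p q" "\<forall>v\<in>V. norm (p v - q v) < \<epsilon>" for q
    unfolding same_distances_def
  proof (intro ballI)
    text \<open>Equality of lengths says that \<open>h = q - p\<close> is an infinitesimal motion of the average \<open>m\<close>.\<close>
    define m where "m v = (1/2) *\<^sub>R (p v + q v)" for v
    define h where "h v = q v - p v" for v
    have mh: "(m x - m y) \<bullet> (h x - h y) = (1/2) * ((dist (q x) (q y))\<^sup>2 - (dist (p x) (p y))\<^sup>2)" for x y
      unfolding dist_norm power2_norm_eq_inner m_def h_def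
      by (simp add: inner_simps algebra_simps inner_commute)
    have "norm (p v - m v) < \<epsilon>" if "v \<in> V" for v
    proof -
      have "p v - m v = (1/2) *\<^sub>R (p v - q v)" by (simp add: m_def vec_eq_iff field_simps)
      then have "norm (p v - m v) = norm (p v - q v) / 2" by simp
      then show ?thesis using bspec[OF q(2) that] norm_ge_zero[of "p v - q v"] by linarith
    qed
    then have ind: "edge_indep m B" using \<epsilon>(2) by blast
    fix u v assume uv: "u \<in> V" "v \<in> V"
    show "dist (p u) (p v) = dist (q u) (q v)"
    proof (cases "u = v")
      case False
      have "edge_row p {u, v} \<in> edge_span p B"
        using edge_span_trans[OF span[of "{u, v}"]] B(4) uv False by (auto simp: doubleton_in_vertex_pairs)
      then have "edge_row m {u, v} \<in> edge_span m B"
        using uv by (intro edge_span_transfer[OF gen finB BV _ ind]) auto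
      moreover have "\<exists>x\<in>V. \<exists>y\<in>V. x \<noteq> y \<and> e = {x, y} \<and> (m x - m y) \<bullet> (h x - h y) = 0" if e: "e \<in> B" for e
      proof -
        obtain x y where xy: "x \<in> V" "y \<in> V" "x \<noteq> y" "e = {x, y}"
          using e B(1) E by (auto simp: vertex_pairs_iff subset_iff)
        then have "dist (p x) (p y) = dist (q x) (q y)"
          using q(1) e B(1) unfolding same_edge_lengths_def by blast
        then have "(m x - m y) \<bullet> (h x - h y) = 0" using mh[of x y] by simp
        then show ?thesis using xy by blast
      qed
      ultimately have "(m u - m v) \<bullet> (h u - h v) = 0"
        using edge_span_motion[OF V] uv by blast
      then show ?thesis using mh[of u v] by simp
    qed simp
  qed
  then show ?thesis using \<epsilon>(1) unfolding rigid_framework_def by blast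
qed

section \<open>Equivalent frameworks\<close>

definition vderiv :: "(real \<Rightarrow> real) \<Rightarrow> real ^ 'd::finite \<Rightarrow> real ^ 'd" where
  "vderiv D u = (\<chi> i. D (u $ i))"

context
  fixes D assumes D: "derivation D"
begin

lemma derivation_add: "D (a + b) = D a + D b"
  and derivation_mult: "D (a * b) = a * D b + D a * b"
  using D unfolding derivation_def by blast+

lemma derivation_zero: "D 0 = 0"
  using derivation_add[of 0 0] by simp

lemma derivation_diff: "D (a - b) = D a - D b"
  using derivation_add[of "a - b" b] by simp

lemma derivation_sum: "D (sum f A) = (\<Sum>x\<in>A. D (f x))"
  by (induction A rule: infinite_finite_induct) (auto simp: derivation_zero derivation_add)

lemma vderiv_diff: "vderiv D (u - w) = vderiv D u - vderiv D w"
  by (simp add: vderiv_def vec_eq_iff derivation_diff)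

lemma vderiv_scaleR_sum:
  "vderiv D (\<Sum>x\<in>A. l x *\<^sub>R a x) = (\<Sum>x\<in>A. D (l x) *\<^sub>R a x) + (\<Sum>x\<in>A. l x *\<^sub>R vderiv D (a x))"
  by (simp add: vderiv_def vec_eq_iff derivation_sum derivation_mult sum.distrib algebra_simps)

lemma derivation_inner: "D (u \<bullet> w) = vderiv D u \<bullet> w + u \<bullet> vderiv D w"
  by (simp add: inner_vec_def vderiv_def derivation_sum derivation_mult sum.distrib algebra_simps)

lemma derivation_equal_dist:
  assumes "dist a b = dist a' b'"
  shows "(a - b) \<bullet> (vderiv D a - vderiv D b) = (a' - b') \<bullet> (vderiv D a' - vderiv D b')"
proof -
  have "(a - b) \<bullet> (a - b) = (a' - b') \<bullet> (a' - b')"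
    using assms by (simp add: dist_norm power2_norm_eq_inner[symmetric])
  then have "D ((a - b) \<bullet> (a - b)) = D ((a' - b') \<bullet> (a' - b'))" by simp
  then show ?thesis by (simp add: derivation_inner vderiv_diff inner_commute)
qed

end

lemma orthonormal_norm:
  fixes y :: "'d::finite \<Rightarrow> real ^ 'd"
  assumes y: "\<And>i j. y i \<bullet> y j = (if i = j then 1 else 0)"
  shows "z \<bullet> z = (\<Sum>i\<in>UNIV. (z \<bullet> y i)\<^sup>2)"
proof -
  have sum_y: "(\<Sum>i\<in>UNIV. l i *\<^sub>R y i) \<bullet> y j = l j" for l j
    by (simp add: inner_sum_left y if_distrib cong: if_cong)
  have "vec_indep UNIV y"
    unfolding vec_indep_def using sum_y by (metis inner_zero_left)
  then have "z - (\<Sum>i\<in>UNIV. (z \<bullet> y i) *\<^sub>R y i) = 0"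
    by (rule vec_indep_orthogonal_eq_0[OF finite])
      (simp_all add: inner_diff_right sum_y inner_commute[of "y _"])
  then have z: "z = (\<Sum>i\<in>UNIV. (z \<bullet> y i) *\<^sub>R y i)" by simp
  have "z \<bullet> z = z \<bullet> (\<Sum>i\<in>UNIV. (z \<bullet> y i) *\<^sub>R y i)" using z by simp
  also have "\<dots> = (\<Sum>i\<in>UNIV. (z \<bullet> y i)\<^sup>2)" by (simp add: inner_sum_right power2_eq_square)
  finally show ?thesis .
qed

lemma generic_placement_derivation:
  assumes "generic_placement V p"
  shows "\<exists>D. derivation D \<and> (\<forall>x\<in>V. vderiv D (p x) = w x)"
proof -
  obtain D where "derivation D" "\<forall>k\<in>V \<times> UNIV. D ((\<lambda>(v, i). p v $ i) k) = (\<lambda>(v, i). w v $ i) k"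
    using alg_independent_derivation assms unfolding generic_placement_def by blast
  then show ?thesis by (intro exI[of _ D]) (auto simp: vderiv_def vec_eq_iff)
qed

text \<open>Differentiating the equal edge lengths of \<open>p\<close> and \<open>q\<close> along derivations shows that every
  equilibrium stress of \<open>q\<close> is one of \<open>p\<close>.\<close>

lemma edge_indep_equivalent:
  fixes p q :: "'a \<Rightarrow> real ^ 'd"
  assumes gen: "generic_placement V p" and V: "finite V" and B: "B \<subseteq> vertex_pairs V"
    and eq: "\<And>x y. {x, y} \<in> B \<Longrightarrow> dist (p x) (p y) = dist (q x) (q y)" and ind: "edge_indep p B"
  shows "edge_indep q B"
  unfolding edge_indep_def
proof (intro allI impI)
  fix l assume l: "\<forall>z. (\<Sum>e\<in>B. l e *\<^sub>R edge_row q e z) = 0"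
  \<comment> \<open>\<open>s\<close> measures the failure of \<open>l\<close> to be a stress of
    \<open>p\<close>. With \<open>s\<close> itself as velocity of \<open>p\<close>, its squared norm
    becomes a pairing of the stress \<open>l\<close> of \<open>q\<close> with a motion of
    \<open>q\<close>, which is zero.\<close>
  define s where "s z = (\<Sum>e\<in>B. l e *\<^sub>R edge_row p e z)" for z
  obtain D where D: "derivation D" "\<forall>x\<in>V. vderiv D (p x) = s x"
    using generic_placement_derivation[OF gen] by blast
  have edge: "(\<Sum>z\<in>V. edge_row p e z \<bullet> s z) = (\<Sum>z\<in>V. edge_row q e z \<bullet> vderiv D (q z))" if e: "e \<in> B" for e
  proof -
    obtain x y where xy: "x \<in> V" "y \<in> V" "x \<noteq> y" "e = {x, y}"
      using e B by (auto simp: vertex_pairs_iff subset_iff)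
    have "(p x - p y) \<bullet> (s x - s y) = (q x - q y) \<bullet> (vderiv D (q x) - vderiv D (q y))"
      using derivation_equal_dist[OF D(1) eq[of x y]] e xy D(2) by simp
    then show ?thesis
      unfolding xy(4) edge_row_pairing[OF V xy(1-3), of p s]
        edge_row_pairing[OF V xy(1-3), of q "\<lambda>z. vderiv D (q z)"] .
  qed
  have "(\<Sum>z\<in>V. s z \<bullet> s z) = (\<Sum>e\<in>B. l e * (\<Sum>z\<in>V. edge_row p e z \<bullet> s z))"
  proof -
    have "(\<Sum>z\<in>V. s z \<bullet> s z) = (\<Sum>z\<in>V. \<Sum>e\<in>B. l e * (edge_row p e z \<bullet> s z))"
      by (rule sum.cong[OF refl]) (subst s_def, simp add: inner_sum_left)
    also have "\<dots> = (\<Sum>e\<in>B. \<Sum>z\<in>V. l e * (edge_row p e z \<bullet> s z))" by (rule sum.swap)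
    finally show ?thesis by (simp add: sum_distrib_left)
  qed
  also have "\<dots> = (\<Sum>e\<in>B. l e * (\<Sum>z\<in>V. edge_row q e z \<bullet> vderiv D (q z)))" using edge by simp
  also have "\<dots> = (\<Sum>e\<in>B. \<Sum>z\<in>V. l e * (edge_row q e z \<bullet> vderiv D (q z)))" by (simp add: sum_distrib_left)
  also have "\<dots> = (\<Sum>z\<in>V. \<Sum>e\<in>B. l e * (edge_row q e z \<bullet> vderiv D (q z)))" by (rule sum.swap)
  also have "\<dots> = (\<Sum>z\<in>V. (\<Sum>e\<in>B. l e *\<^sub>R edge_row q e z) \<bullet> vderiv D (q z))" by (simp add: inner_sum_left)
  also have "\<dots> = 0" using l by simp
  finally have "s z = 0" if "z \<in> V" for z
    using V that by (simp add: sum_nonneg_eq_0_iff)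
  moreover have "s z = 0" if "z \<notin> V" for z
    unfolding s_def using that B by (intro sum.neutral) (auto simp: edge_row_def vertex_pairs_def)
  ultimately have "s z = 0" for z by blast
  then show "\<forall>e\<in>B. l e = 0" using edge_indepD[OF ind] by (simp add: s_def)
qed

text \<open>Let \<open>D i\<close> move \<open>p v\<close> in direction \<open>i\<close> and fix all other points of \<open>p\<close>. Modulo the infinitesimal
  isometry \<open>A i\<close>, it fixes \<open>q\<close> on \<open>W\<close> and moves \<open>q v\<close> with velocity \<open>z i\<close>; a second differentiation
  shows that the \<open>z i\<close> are orthonormal.\<close>

lemma neighbourhood_congruent:
  fixes p q :: "'a \<Rightarrow> real ^ 'd"
  assumes gen: "generic_placement V p" and V: "finite V" and J: "J \<subseteq> vertex_pairs V"
    and eq: "\<And>x y. {x, y} \<in> J \<Longrightarrow> dist (p x) (p y) = dist (q x) (q y)"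
    and v: "v \<in> V" and W: "W \<subseteq> V" "v \<notin> W" "card W = CARD('d) + 1" "\<And>w. w \<in> W \<Longrightarrow> {v, w} \<in> J"
    and linked: "\<And>e. e \<in> vertex_pairs W \<Longrightarrow> edge_row p e \<in> edge_span p {e \<in> J. v \<notin> e}"
    and xy: "x \<in> W" "y \<in> W"
  shows "dist (p x) (p y) = dist (q x) (q y)"
proof -
  let ?F = "{e \<in> J. v \<notin> e}"
  have finF: "finite ?F" using finite_subset[OF J finite_vertex_pairs[OF V]] by simp
  have finW: "finite W" by (rule finite_subset[OF W(1) V])
  obtain B where B: "B \<subseteq> ?F" "edge_indep p B" "card B = edge_rank p ?F" "edge_row p ` ?F \<subseteq> edge_span p B"
    by (rule edge_basis[OF finF])
  have finB: "finite B" by (rule finite_subset[OF B(1) finF])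
  have BV: "B \<subseteq> vertex_pairs V" using B(1) J by blast
  have ind: "edge_indep q B"
    by (rule edge_indep_equivalent[OF gen V BV eq B(2)]) (use B(1) in blast)
  have linked_q: "edge_row q {x, y} \<in> edge_span q B" if "x \<in> W" "y \<in> W" "x \<noteq> y" for x y
  proof (rule edge_span_transfer[OF gen finB _ _ ind])
    have "edge_row p {x, y} \<in> edge_span p ?F" using that by (intro linked) (simp add: doubleton_in_vertex_pairs)
    then show "edge_row p {x, y} \<in> edge_span p B" by (rule edge_span_trans) (use B(4) in blast)
  qed (use that BV W in \<open>auto simp: vertex_pairs_def\<close>)
  have "\<exists>D. derivation D \<and> (\<forall>x\<in>V. vderiv D (p x) = (if x = v then axis i 1 else 0))" for i
    by (rule generic_placement_derivation[OF gen])
  then obtain D where D: "\<And>i. derivation (D i)"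
    and Dp: "\<And>i x. x \<in> V \<Longrightarrow> vderiv (D i) (p x) = (if x = v then axis i 1 else 0)"
    by metis
  define dq where "dq i x = vderiv (D i) (q x)" for i x
  have dq_edge: "(p x - p y) \<bullet> (vderiv (D i) (p x) - vderiv (D i) (p y)) = (q x - q y) \<bullet> (dq i x - dq i y)"
    if "{x, y} \<in> J" for i x y
    unfolding dq_def using derivation_equal_dist[OF D eq[OF that]] .
  \<comment> \<open>The edges of \<open>B\<close> avoid \<open>v\<close>, so \<open>D i\<close> does
    not move their ends in \<open>p\<close>; their lengths in \<open>q\<close> are then preserved to
    first order, and with them all lengths within \<open>W\<close>.\<close>
  have dqW: "(q x - q y) \<bullet> (dq i x - dq i y) = 0" if xyW: "x \<in> W" "y \<in> W" for i x y
  proof (cases "x = y")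
    case False
    have "\<exists>x\<in>V. \<exists>y\<in>V. x \<noteq> y \<and> e = {x, y} \<and> (q x - q y) \<bullet> (dq i x - dq i y) = 0" if e: "e \<in> B" for e
    proof -
      obtain x y where xy: "x \<in> V" "y \<in> V" "x \<noteq> y" "e = {x, y}"
        using e BV by (auto simp: vertex_pairs_iff subset_iff)
      moreover have "e \<in> J" "v \<notin> e" using e B(1) by auto
      ultimately have "(q x - q y) \<bullet> (dq i x - dq i y) = 0" using dq_edge[of x y i] Dp by auto
      then show ?thesis using xy by blast
    qed
    then show ?thesis
      using edge_span_motion[OF V] linked_q[OF xyW False] xyW W(1) by blast
  qed simp
  have dqv: "(p v - p w) $ i = (q v - q w) \<bullet> (dq i v - dq i w)" if w: "w \<in> W" for w i
  proof -
    have "w \<in> V" "w \<noteq> v" using w W by auto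
    then show ?thesis using dq_edge[OF W(4)[OF w], of i] Dp v by (simp add: inner_axis)
  qed
  obtain w0 where w0: "w0 \<in> W" using xy by blast
  define X where "X = W - {w0}"
  have X: "finite X" "card X = CARD('d)" "X \<subseteq> W" "w0 \<notin> X"
    using finW W(3) w0 by (auto simp: X_def)
  define a where "a x = q x - q w0" for x
  define b where "b i x = dq i x - dq i w0" for i x
  define s where "s = q v - q w0"
  define t where "t i = dq i v - dq i w0" for i
  have Da: "vderiv (D i) (a x) = b i x" for i x by (simp add: a_def b_def dq_def vderiv_diff[OF D])
  have Ds: "vderiv (D i) s = t i" for i by (simp add: s_def t_def dq_def vderiv_diff[OF D])
  have ab: "a x \<bullet> b i x = 0" if "x \<in> W" for i x
    using dqW[OF that w0] by (simp add: a_def b_def)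
  have skew: "a x \<bullet> b i y + a y \<bullet> b i x = 0" if "x \<in> W" "y \<in> W" for i x y
    using dqW[OF that, of i] ab[OF that(1), of i] ab[OF that(2), of i]
    by (simp add: a_def b_def inner_simps algebra_simps)
  have st: "(p v - p w0) $ i = s \<bullet> t i" for i
    using dqv[OF w0] by (simp add: s_def t_def)
  have lin: "(p x - p w0) $ i = a x \<bullet> t i + s \<bullet> b i x" if "x \<in> W" for x i
  proof -
    have "(p v - p x) $ i = (s - a x) \<bullet> (t i - b i x)"
      using dqv[OF that] by (simp add: s_def t_def a_def b_def)
    then show ?thesis using st[of i] ab[OF that, of i]
      by (simp add: inner_simps algebra_simps inner_commute)
  qed
  have indX: "vec_indep X a"
    unfolding vec_indep_def
  proof (intro allI impI)
    fix l assume l: "(\<Sum>x\<in>X. l x *\<^sub>R a x) = 0"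
    have "(\<Sum>x\<in>X. l x *\<^sub>R (p x - p w0)) $ i = 0" for i
    proof -
      \<comment> \<open>\<open>\<beta>\<close> is orthogonal to every \<open>a y\<close> by
        skewness, and differentiating the relation puts it into their span, so it is zero. Then
        \<open>lin\<close> carries the relation over to the points of \<open>p\<close>, which are in
        general position.\<close>
      define \<beta> where "\<beta> = (\<Sum>x\<in>X. l x *\<^sub>R b i x)"
      have \<beta>a: "a y \<bullet> \<beta> = 0" if y: "y \<in> X" for y
      proof -
        have "a y \<bullet> \<beta> = (\<Sum>x\<in>X. l x * (a y \<bullet> b i x))" by (simp add: \<beta>_def inner_sum_right)
        also have "\<dots> = (\<Sum>x\<in>X. - (l x * (a x \<bullet> b i y)))"
        proof (rule sum.cong[OF refl])
          fix x assume x: "x \<in> X"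
          have "a y \<bullet> b i x = - (a x \<bullet> b i y)"
            using skew[of y x i] x y X(3) by (simp add: eq_neg_iff_add_eq_0 subset_iff)
          then show "l x * (a y \<bullet> b i x) = - (l x * (a x \<bullet> b i y))" by simp
        qed
        also have "\<dots> = - ((\<Sum>x\<in>X. l x *\<^sub>R a x) \<bullet> b i y)" by (simp add: inner_sum_left sum_negf)
        finally show ?thesis using l by simp
      qed
      have "vderiv (D i) 0 = (\<Sum>x\<in>X. D i (l x) *\<^sub>R a x) + \<beta>"
        unfolding l[symmetric] vderiv_scaleR_sum[OF D] by (simp add: Da \<beta>_def)
      moreover define \<gamma> where "\<gamma> = (\<Sum>x\<in>X. D i (l x) *\<^sub>R a x)"
      ultimately have "\<beta> = - \<gamma>"
        by (simp add: vderiv_def derivation_zero[OF D] vec_eq_iff eq_neg_iff_add_eq_0 add.commute)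
      moreover have "\<gamma> \<bullet> \<beta> = 0" using \<beta>a by (simp add: \<gamma>_def inner_sum_left)
      ultimately have \<beta>0: "\<beta> = 0" by (metis inner_minus_left inner_eq_zero_iff minus_zero)
      have "(\<Sum>x\<in>X. l x *\<^sub>R (p x - p w0)) $ i = (\<Sum>x\<in>X. l x * (p x - p w0) $ i)" by simp
      also have "\<dots> = (\<Sum>x\<in>X. l x * (a x \<bullet> t i) + l x * (s \<bullet> b i x))"
        using X(3) lin by (intro sum.cong refl) (auto simp: algebra_simps simp del: vector_minus_component)
      also have "\<dots> = (\<Sum>x\<in>X. l x *\<^sub>R a x) \<bullet> t i + s \<bullet> \<beta>"
        by (simp add: inner_sum_left inner_sum_right \<beta>_def sum.distrib)
      finally show ?thesis using l \<beta>0 by simp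
    qed
    then have "(\<Sum>x\<in>X. l x *\<^sub>R (p x - p w0)) = 0" by (simp add: vec_eq_iff)
    moreover have "vec_indep X (\<lambda>x. p x - p w0)"
      by (rule generic_vec_indep[OF gen]) (use X W w0 in auto)
    ultimately show "\<forall>x\<in>X. l x = 0" using vec_indepD[of X "\<lambda>x. p x - p w0" l] by blast
  qed
  have "\<exists>A. linear A \<and> (\<forall>x\<in>X. A (a x) = b i x) \<and> (\<forall>u v. u \<bullet> A v = - (A u \<bullet> v))" for i
    by (rule skew_map_exists[OF X(1) indX X(2)]) (use skew X(3) in auto)
  then obtain A where A: "\<And>i. linear (A i)" "\<And>i x. x \<in> X \<Longrightarrow> A i (a x) = b i x"
    "\<And>i u v. u \<bullet> A i v = - (A i u \<bullet> v)" by metis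
  have A_self: "u \<bullet> A i u = 0" for u i using A(3)[of u i u] by (simp add: inner_commute)
  define z where "z i = t i - A i s" for i
  have az: "a x \<bullet> z i = (p x - p w0) $ i" if "x \<in> X" for x i
  proof -
    have "a x \<bullet> A i s = - (s \<bullet> b i x)" using A(3)[of "a x" i s] A(2)[OF that, of i] by (simp add: inner_commute)
    then show ?thesis using lin[of x i] that X(3) by (auto simp: z_def inner_diff_right)
  qed
  have sz: "s \<bullet> z i = (p v - p w0) $ i" for i
    using st[of i] A_self[of s i] by (simp add: z_def inner_diff_right)
  have ortho: "z i \<bullet> z j = (if i = j then 1 else 0)" for i j
  proof -
    \<comment> \<open>The products \<open>a x \<bullet> z j\<close> are coordinate differences of
      points of \<open>p\<close> that \<open>D i\<close> fixes, so \<open>z j\<close> has to rotate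
      with \<open>A i\<close>. Differentiating \<open>s \<bullet> z j\<close>, which involves
      \<open>p v\<close>, then yields \<open>z i \<bullet> z j\<close>.\<close>
    define y where "y = vderiv (D i) (z j)"
    have w0V: "w0 \<in> V" "w0 \<noteq> v" using w0 W by auto
    have Dcoord: "D i (p x $ j) = (if x = v \<and> i = j then 1 else 0)" if "x \<in> V" for x
      using arg_cong[OF Dp[OF that, of i], of "\<lambda>u. u $ j"] by (auto simp: vderiv_def axis_def)
    have "y - A i (z j) = 0"
    proof (rule vec_indep_orthogonal_eq_0[OF X(1) indX X(2)])
      fix x assume x: "x \<in> X"
      then have xV: "x \<in> V" "x \<noteq> v" using X W by auto
      have "D i (a x \<bullet> z j) = 0"
        using az[OF x, of j] Dcoord[OF xV(1)] Dcoord[OF w0V(1)] xV w0V by (simp add: derivation_diff[OF D])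
      then have "b i x \<bullet> z j + a x \<bullet> y = 0" by (simp add: derivation_inner[OF D] Da y_def)
      moreover have "a x \<bullet> A i (z j) = - (b i x \<bullet> z j)" using A(3)[of "a x" i "z j"] A(2)[OF x] by simp
      ultimately show "a x \<bullet> (y - A i (z j)) = 0" by (simp add: inner_diff_right)
    qed
    then have y: "y = A i (z j)" by simp
    have "D i (s \<bullet> z j) = (if i = j then 1 else 0)"
      using sz[of j] Dcoord[OF v] Dcoord[OF w0V(1)] w0V by (simp add: derivation_diff[OF D])
    then have "t i \<bullet> z j + s \<bullet> A i (z j) = (if i = j then 1 else 0)"
      by (simp only: derivation_inner[OF D] Ds y[symmetric] y_def[symmetric])
    moreover have "s \<bullet> A i (z j) = - (A i s \<bullet> z j)" by (rule A(3))
    ultimately show ?thesis by (simp add: z_def[of i] inner_diff_left)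
  qed
  have az': "a x \<bullet> z i = (p x - p w0) $ i" if "x \<in> W" for x i
  proof (cases "x = w0")
    case False
    then show ?thesis using az that by (simp add: X_def)
  qed (simp add: a_def)
  have coord: "(q x - q y) \<bullet> z i = (p x - p y) $ i" for i
    using az'[OF xy(1), of i] az'[OF xy(2), of i] by (simp add: a_def inner_simps algebra_simps)
  \<comment> \<open>In the orthonormal basis \<open>z\<close>, the vector \<open>q x - q y\<close>
    has the coordinates of \<open>p x - p y\<close>.\<close>
  have "(q x - q y) \<bullet> (q x - q y) = (\<Sum>i\<in>UNIV. ((p x - p y) $ i)\<^sup>2)"
    unfolding orthonormal_norm[OF ortho, of "q x - q y"] coord ..
  also have "\<dots> = (p x - p y) \<bullet> (p x - p y)" by (simp add: inner_vec_def power2_eq_square)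
  finally show ?thesis by (simp add: dist_norm norm_eq_sqrt_inner)
qed

section \<open>Connectivity\<close>

definition neighbours :: "'a set set \<Rightarrow> 'a \<Rightarrow> 'a set" where
  "neighbours J v = {w. {v, w} \<in> J}"

lemma neighbours_subset: "J \<subseteq> vertex_pairs V \<Longrightarrow> neighbours J v \<subseteq> V - {v}"
proof
  fix w assume "J \<subseteq> vertex_pairs V" "w \<in> neighbours J v"
  then have "{v, w} \<in> vertex_pairs V" by (auto simp: neighbours_def)
  then show "w \<in> V - {v}" by (auto simp: doubleton_in_vertex_pairs)
qed

lemma k_connected_mono:
  assumes "k_connected k V E" "E \<subseteq> E'"
  shows "k_connected k V E'"
proof -
  have "{(x, y). {x, y} \<in> {e \<in> E. e \<inter> S = {}}}\<^sup>* \<subseteq> {(x, y). {x, y} \<in> {e \<in> E'. e \<inter> S = {}}}\<^sup>*" for S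
    by (rule rtrancl_mono) (use assms(2) in auto)
  then show ?thesis
    using assms(1) unfolding k_connected_def connected_graph_def by blast
qed

text \<open>Fewer than \<open>k\<close> neighbours would separate \<open>v\<close> from some further
  vertex, which exists because there are more than \<open>k\<close> vertices.\<close>

lemma k_connected_degree:
  assumes V: "finite V" "E \<subseteq> vertex_pairs V" and con: "k_connected k V E" and v: "v \<in> V"
  shows "k \<le> card (neighbours E v)"
proof (rule ccontr)
  assume "\<not> k \<le> card (neighbours E v)"
  then have lt: "card (neighbours E v) < k" by simp
  let ?S = "neighbours E v"
  have S: "?S \<subseteq> V" "v \<notin> ?S" using neighbours_subset[OF V(2), of v] by auto
  have "card (insert v ?S) < card V"
    using lt con S finite_subset[OF S(1) V(1)] by (simp add: k_connected_def)
  then have "\<not> V \<subseteq> insert v ?S"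
    using card_mono[of "insert v ?S" V] finite_subset[OF S(1) V(1)] by auto
  then obtain u where u: "u \<in> V" "u \<noteq> v" "u \<notin> ?S" by blast
  have "connected_graph (V - ?S) {e \<in> E. e \<inter> ?S = {}}"
    using con lt S unfolding k_connected_def by blast
  then have "(v, u) \<in> {(x, y). {x, y} \<in> {e \<in> E. e \<inter> ?S = {}}}\<^sup>*"
    using u v S unfolding connected_graph_def by blast
  then show False
  proof (cases rule: converse_rtranclE)
    case base then show False using u by simp
  next
    case (step y)
    then have "{v, y} \<in> E" "{v, y} \<inter> ?S = {}" by auto
    then show False by (auto simp: neighbours_def)
  qed
qed

text \<open>A passage of a path through \<open>v\<close> is replaced by the edge between the
  vertices before and after \<open>v\<close>. The bound on \<open>card V\<close> leaves more than
  \<open>k\<close> vertices.\<close>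

lemma k_connected_remove_simplicial:
  assumes V: "finite V" "E \<subseteq> vertex_pairs V" and con: "k_connected k V E" and v: "v \<in> V"
    and simplicial: "vertex_pairs (neighbours E v) \<subseteq> E" and card: "card V > k + 1"
  shows "k_connected k (V - {v}) {e \<in> E. v \<notin> e}"
  unfolding k_connected_def
proof (intro conjI allI impI)
  show "k < card (V - {v})" using card v V(1) by simp
next
  fix S assume S: "S \<subseteq> V - {v}" "card S < k"
  let ?R = "{(x, y). {x, y} \<in> {e \<in> E. e \<inter> S = {}}}"
  let ?R' = "{(x, y). {x, y} \<in> {e \<in> {e \<in> E. v \<notin> e}. e \<inter> S = {}}}"
  have conS: "connected_graph (V - S) {e \<in> E. e \<inter> S = {}}"
    using con S unfolding k_connected_def by blast
  \<comment> \<open>Induction along the path: while it stands at \<open>v\<close>, the vertex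
    \<open>u\<close> before \<open>v\<close> is remembered, to be joined to the next one.\<close>
  have path: "(z \<noteq> v \<longrightarrow> (x, z) \<in> ?R'\<^sup>*) \<and> (z = v \<longrightarrow> (\<exists>u. (x, u) \<in> ?R'\<^sup>* \<and> (u, v) \<in> ?R \<and> u \<noteq> v))"
    if "(x, z) \<in> ?R\<^sup>*" and x: "x \<noteq> v" for x z
    using that(1)
  proof (induction rule: rtrancl_induct)
    case base then show ?case using x by simp
  next
    case (step y z)
    have yz: "{y, z} \<in> E" "{y, z} \<inter> S = {}" using step.hyps by auto
    have "{y, z} \<in> vertex_pairs V" using yz(1) V(2) by blast
    then have "y \<noteq> z" by (simp add: doubleton_in_vertex_pairs)
    show ?case
    proof (cases "y = v")
      case False
      then have xy: "(x, y) \<in> ?R'\<^sup>*" using step.IH by blast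
      show ?thesis
      proof (cases "z = v")
        case True
        then show ?thesis using xy step.hyps False by blast
      next
        case zv: False
        then have "(y, z) \<in> ?R'" using yz False by auto
        then show ?thesis using xy zv by (meson rtrancl.rtrancl_into_rtrancl)
      qed
    next
      case True
      then have zv: "z \<noteq> v" using \<open>y \<noteq> z\<close> by blast
      obtain u where u: "(x, u) \<in> ?R'\<^sup>*" "(u, v) \<in> ?R" "u \<noteq> v" using step.IH True by blast
      show ?thesis
      proof (cases "u = z")
        case True then show ?thesis using u zv by blast
      next
        case False
        have "{u, z} \<in> vertex_pairs (neighbours E v)"
          using u(2) yz True False by (auto simp: doubleton_in_vertex_pairs neighbours_def insert_commute)
        then have "(u, z) \<in> ?R'" using simplicial u yz zv by auto
        then show ?thesis using u(1) zv by (meson rtrancl.rtrancl_into_rtrancl)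
      qed
    qed
  qed
  show "connected_graph (V - {v} - S) {e \<in> {e \<in> E. v \<notin> e}. e \<inter> S = {}}"
    unfolding connected_graph_def
  proof (intro conjI ballI)
    have "card S < card (V - {v})" using S(2) card v V(1) by simp
    moreover have "finite S" using finite_subset[OF S(1)] V(1) by simp
    ultimately show "V - {v} - S \<noteq> {}" using card_mono[of S "V - {v}"] by auto
  next
    fix a b assume ab: "a \<in> V - {v} - S" "b \<in> V - {v} - S"
    then have "(a, b) \<in> ?R\<^sup>*" using conS unfolding connected_graph_def by blast
    then show "(a, b) \<in> ?R'\<^sup>*" using path[of a b] ab by blast
  qed
qed

section \<open>Averaging over vertex orders\<close>

text \<open>\<open>vertex_weight d cl n\<close> is a lower bound for the expected gain in rank when, in a random vertex order, a vertex with
  \<open>n\<close> neighbours is added to its predecessors; \<open>cl\<close> says whether the neighbours form a clique.\<close>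

definition vertex_weight :: "nat \<Rightarrow> bool \<Rightarrow> nat \<Rightarrow> real" where
  "vertex_weight d cl n =
     (if n < d then n / 2
      else if cl then d - (d * (d + 1)) / (2 * (n + 1))
      else d + (real n - d * (d + 1)) / (2 * n))"

definition rank_gain :: "nat \<Rightarrow> bool \<Rightarrow> nat \<Rightarrow> nat" where
  "rank_gain d cl n = min d n + (if d + 1 \<le> n \<and> \<not> cl then 1 else 0)"

lemma vertex_weight_clique_le:
  assumes "1 \<le> d" "d \<le> n"
  shows "vertex_weight d True n \<le> vertex_weight d False n"
proof -
  have n: "real n \<ge> 1" "real d \<ge> 1" "real d \<le> real n" using assms by auto
  have "real d * (real d + 1) \<le> real n * (real n + 1)" using n by (intro mult_mono) auto
  moreover have "vertex_weight d False n - vertex_weight d True n =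
      (real n * (real n + 1) - real d * (real d + 1)) / (2 * real n * (real n + 1))"
  proof -
    have "(real n - c) / (2 * n) + c / (2 * (real n + 1)) = (real n * (real n + 1) - c) / (2 * n * (real n + 1))" for c
      using n by (simp add: divide_simps) (simp add: algebra_simps)
    from this[of "real d * (real d + 1)"] show ?thesis using assms by (simp add: vertex_weight_def algebra_simps)
  qed
  moreover have "(real n * (real n + 1) - real d * (real d + 1)) / (2 * real n * (real n + 1)) \<ge> 0"
    by (rule divide_nonneg_nonneg) (use calculation(1) n in auto)
  ultimately have "vertex_weight d False n - vertex_weight d True n \<ge> 0" by (simp only:)
  then show ?thesis by simp
qed

text \<open>Among a vertex and its n neighbours each comes last with probability 1/(n+1). If the
  vertex is last, it earns \<open>rank_gain\<close>; if a neighbour \<open>x\<close> is last, the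
  expectation for \<open>M - {x}\<close> remains. The hypothesis \<open>uniq\<close> will come from
  gluing.\<close>

lemma vertex_weight_recursion:
  assumes d: "1 \<le> d" and M: "finite M"
    and sub: "\<And>x. cl M \<Longrightarrow> x \<in> M \<Longrightarrow> cl (M - {x})"
    and uniq: "\<And>x y. d + 2 \<le> card M \<Longrightarrow> x \<in> M \<Longrightarrow> y \<in> M \<Longrightarrow> x \<noteq> y \<Longrightarrow> cl (M - {x}) \<Longrightarrow> cl (M - {y}) \<Longrightarrow> cl M"
  shows "(card M + 1) * vertex_weight d (cl M) (card M) \<le>
    rank_gain d (cl M) (card M) + (\<Sum>x\<in>M. vertex_weight d (cl (M - {x})) (card M - 1))"
proof -
  define n where "n = card M"
  let ?S = "\<Sum>x\<in>M. vertex_weight d (cl (M - {x})) (n - 1)"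
  have const: "?S = n * w" if "\<And>x. x \<in> M \<Longrightarrow> vertex_weight d (cl (M - {x})) (n - 1) = w" for w :: real
    using that by (simp add: n_def)
  have d1: "real d \<ge> 1" using d by simp
  consider "n = 0" | "0 < n" "n \<le> d" | "d < n" "cl M" | "n = d + 1" "\<not> cl M" | "d + 2 \<le> n" "\<not> cl M"
    by linarith
  then have "(n + 1) * vertex_weight d (cl M) n \<le> rank_gain d (cl M) n + ?S"
  proof cases
    case 1
    then show ?thesis using d by (simp add: vertex_weight_def)
  next
    case 2
    have "?S = n * ((real n - 1) / 2)"
      by (rule const) (use 2 in \<open>auto simp: vertex_weight_def of_nat_diff\<close>)
    moreover have "vertex_weight d (cl M) n = n / 2"
      using 2 d1 by (cases "n = d") (auto simp: vertex_weight_def field_simps)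
    moreover have "rank_gain d (cl M) n = n" using 2 by (simp add: rank_gain_def)
    ultimately show ?thesis by (simp only:) (simp add: field_simps)
  next
    case 3
    have "?S = n * (d - (real d * (real d + 1)) / (2 * n))"
      by (rule const) (use sub 3 in \<open>auto simp: vertex_weight_def of_nat_diff algebra_simps\<close>)
    moreover have "rank_gain d (cl M) n = d" using 3 by (simp add: rank_gain_def)
    moreover have "vertex_weight d (cl M) n = d - (real d * (real d + 1)) / (2 * (real n + 1))"
      using 3 by (simp add: vertex_weight_def algebra_simps)
    moreover have "(real n + 1) * (d - c / (2 * (real n + 1))) = d + n * (d - c / (2 * n))" for c
      using 3 by (simp add: field_simps)
    ultimately have "(real n + 1) * vertex_weight d (cl M) n = rank_gain d (cl M) n + ?S" by (simp only:)
    then show ?thesis by (simp add: add.commute)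
  next
    case 4
    have "?S = n * (d / 2)"
      by (rule const) (use 4 d1 in \<open>auto simp: vertex_weight_def field_simps\<close>)
    moreover have "rank_gain d (cl M) n = d + 1" using 4 by (simp add: rank_gain_def)
    moreover have "vertex_weight d (cl M) n = (d + 1) / 2"
      using 4 by (simp add: vertex_weight_def field_simps)
    ultimately show ?thesis by (simp only: \<open>n = d + 1\<close>) (simp add: field_simps)
  next
    case 5
    have le: "vertex_weight d True (n - 1) \<le> vertex_weight d False (n - 1)"
      using 5 d by (intro vertex_weight_clique_le) auto
    have "M \<noteq> {}" using 5 by (auto simp: n_def)
    \<comment> \<open>By \<open>uniq\<close> at most one neighbour leaves a clique when removed, so
      at least n - 1 terms of the sum carry the larger, non-clique weight.\<close>
    have "\<exists>x\<in>M. \<forall>y\<in>M - {x}. \<not> cl (M - {y})"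
    proof (cases "\<exists>x\<in>M. cl (M - {x})")
      case True
      then show ?thesis using uniq 5 unfolding n_def by blast
    next
      case False
      then show ?thesis using \<open>M \<noteq> {}\<close> by blast
    qed
    then obtain x where x: "x \<in> M" "\<And>y. y \<in> M - {x} \<Longrightarrow> \<not> cl (M - {y})" by blast
    have "?S = vertex_weight d (cl (M - {x})) (n - 1) + (\<Sum>y\<in>M - {x}. vertex_weight d (cl (M - {y})) (n - 1))"
      using M x(1) by (simp add: sum.remove)
    also have "(\<Sum>y\<in>M - {x}. vertex_weight d (cl (M - {y})) (n - 1)) = (real n - 1) * vertex_weight d False (n - 1)"
      using x M 5 by (simp add: n_def of_nat_diff)
    finally have "?S \<ge> vertex_weight d True (n - 1) + (real n - 1) * vertex_weight d False (n - 1)"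
      using le by (cases "cl (M - {x})") auto
    moreover define c where "c = real d * (real d + 1)"
    have vw: "vertex_weight d True m = d - c / (2 * (real m + 1))"
      "vertex_weight d False m = d + (real m - c) / (2 * real m)" if "d \<le> m" for m
      using that by (simp_all add: vertex_weight_def c_def algebra_simps)
    have n1: "real n > 1" "real (n - 1) = real n - 1" using 5 by auto
    have "vertex_weight d True (n - 1) = d - c / (2 * n)"
      "(real n - 1) * vertex_weight d False (n - 1) = (real n - 1) * d + (real n - 1 - c) / 2"
      using 5 n1 by (simp_all add: vw field_simps)
    moreover have "rank_gain d (cl M) n = d + 1" using 5 by (simp add: rank_gain_def)
    moreover have "(n + 1) * vertex_weight d (cl M) n = (real n + 1) * (d + (real n - c) / (2 * n))"
      using 5 by (simp add: vw algebra_simps)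
    moreover have "(real n + 1) * (d + (real n - c) / (2 * n)) =
        real (d + 1) + (d - c / (2 * n) + ((real n - 1) * d + (real n - 1 - c) / 2))"
      using n1 by (simp add: field_simps)
    ultimately show ?thesis by linarith
  qed
  then show ?thesis by (simp add: n_def)
qed

text \<open>Put c = d(d+1). A non-clique falls short of d by (c - n)/(2n), which is at most e/2
  since c - n <= e. A clique falls short by c/(2(n+1)) even for e = 0, hence the assumption that
  \<open>e\<close> is then positive.\<close>

lemma vertex_weight_lower_bound:
  fixes d e n :: nat
  assumes d: "1 \<le> d" and e: "2 * e \<le> d * (d + 1)" and n: "d * (d + 1) \<le> n + e"
    and cl: "cl \<Longrightarrow> 1 \<le> e"
  shows "real d - e / 2 \<le> vertex_weight d cl n"
proof -
  let ?c = "real d * (real d + 1)"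
  have "d * 2 \<le> d * (d + 1)" using d by (intro mult_le_mono) auto
  then have dn: "d \<le> n" using e n by linarith
  have e': "2 * real e \<le> ?c" and n': "?c \<le> real n + real e"
    using e n by (metis of_nat_le_iff of_nat_mult of_nat_add of_nat_1 of_nat_numeral)+
  have n1: "real n \<ge> 1" using dn d by simp
  show ?thesis
  proof (cases cl)
    case True
    then have e1: "real e \<ge> 1" using cl by simp
    \<comment> \<open>Expanded, this says \<open>?c \<le> e * (?c - e + 1)\<close>, and
      \<open>?c - e\<close> is at most \<open>n\<close>.\<close>
    have "0 \<le> (real e - 1) * (?c - real e)" using e1 e' by (intro mult_nonneg_nonneg) auto
    also have "\<dots> = real e * (?c - real e + 1) - ?c" by (simp add: algebra_simps)
    also have "\<dots> \<le> real e * (real n + 1) - ?c" using n' e1 by (intro diff_right_mono mult_left_mono) auto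
    finally have "?c \<le> real e * (real n + 1)" by simp
    then have "?c / (2 * (real n + 1)) \<le> real e / 2" using n1 by (simp add: field_simps)
    then show ?thesis using True dn by (simp add: vertex_weight_def algebra_simps)
  next
    case False
    have "?c - real n \<le> real e * 1" using n' by simp
    also have "\<dots> \<le> real e * real n" using n1 by (intro mult_left_mono) auto
    finally have "(?c - real n) / (2 * real n) \<le> real e / 2" using n1 by (simp add: field_simps)
    moreover have "(real n - ?c) / (2 * real n) = - ((?c - real n) / (2 * real n))" by (simp add: minus_divide_left)
    ultimately show ?thesis using False dn by (simp add: vertex_weight_def)
  qed
qed

section \<open>Neighbourhood-closed graphs\<close>

definition nbr_closed :: "('a \<Rightarrow> real ^ 'd::finite) \<Rightarrow> 'a set \<Rightarrow> 'a set set \<Rightarrow> bool" where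
  "nbr_closed p V J \<longleftrightarrow>
     (\<forall>v\<in>V. \<forall>W\<subseteq>neighbours J v. CARD('d) + 1 \<le> card W \<longrightarrow>
        (\<forall>e\<in>vertex_pairs W. edge_row p e \<in> edge_span p {e \<in> J. v \<notin> e}) \<longrightarrow> vertex_pairs W \<subseteq> J)"

definition induced :: "'a set set \<Rightarrow> 'a set \<Rightarrow> 'a set set" where
  "induced J S = {e \<in> J. e \<subseteq> S}"

abbreviation clique :: "'a set set \<Rightarrow> 'a set \<Rightarrow> bool" where
  "clique J M \<equiv> vertex_pairs M \<subseteq> J"

lemma vertex_pairs_mono: "A \<subseteq> B \<Longrightarrow> vertex_pairs A \<subseteq> vertex_pairs B"
  by (auto simp: vertex_pairs_def)

context
  fixes p :: "'a \<Rightarrow> real ^ 'd" and V :: "'a set" and J :: "'a set set"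
  assumes gen: "generic_placement V p" and V: "finite V" and J: "J \<subseteq> vertex_pairs V"
    and closed: "nbr_closed p V J"
begin

lemma nbr_closedD:
  assumes "v \<in> V" "W \<subseteq> neighbours J v" "CARD('d) + 1 \<le> card W"
    "\<And>e. e \<in> vertex_pairs W \<Longrightarrow> edge_row p e \<in> edge_span p {e \<in> J. v \<notin> e}"
  shows "clique J W"
  using closed assms unfolding nbr_closed_def by blast

text \<open>If \<open>M\<close> is large and not a clique, the closure rule read backwards gives a
  pair of \<open>M\<close> outside the span of \<open>J\<close> minus \<open>v\<close>. It can be
  added to a basis of \<open>induced J S\<close>, and a 1-extension through it gains d + 1.
  Otherwise a 0-extension is used.\<close>

lemma rank_gain_step:
  assumes S: "S \<subseteq> V" and v: "v \<in> V" "v \<notin> S"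
  defines "M \<equiv> neighbours J v \<inter> S"
  shows "edge_rank p (induced J S) + rank_gain CARD('d) (clique J M) (card M) \<le> edge_rank p (induced J (insert v S))"
proof -
  have finJ: "finite J" by (rule finite_subset[OF J finite_vertex_pairs[OF V]])
  have finS: "finite (induced J S)" "finite (induced J (insert v S))" using finJ by (auto simp: induced_def)
  have finM: "finite M" using finite_subset[OF S V] by (simp add: M_def)
  obtain B where B: "B \<subseteq> induced J S" "edge_indep p B" "card B = edge_rank p (induced J S)"
    "edge_row p ` induced J S \<subseteq> edge_span p B"
    by (rule edge_basis[OF finS(1)])
  have finB: "finite B" by (rule finite_subset[OF B(1) finS(1)])
  have Bv: "v \<notin> e" "e \<subseteq> V - {v}" if "e \<in> B" for e
    using that B(1) S v by (auto simp: induced_def)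
  have star: "B \<union> (\<lambda>x. {v, x}) ` X \<subseteq> induced J (insert v S)" "card (B \<union> (\<lambda>x. {v, x}) ` X) = card B + card X"
    if X: "X \<subseteq> M" for X
  proof -
    show "B \<union> (\<lambda>x. {v, x}) ` X \<subseteq> induced J (insert v S)"
      using X B(1) by (auto simp: induced_def M_def neighbours_def)
    have "inj_on (\<lambda>x. {v, x}) X" by (auto simp: inj_on_def doubleton_eq_iff)
    moreover have "B \<inter> (\<lambda>x. {v, x}) ` X = {}" using Bv by auto
    ultimately show "card (B \<union> (\<lambda>x. {v, x}) ` X) = card B + card X"
      using finB finite_subset[OF X finM] by (simp add: card_Un_disjoint card_image)
  qed
  show ?thesis
  proof (cases "CARD('d) + 1 \<le> card M \<and> \<not> clique J M")
    case False
    obtain X where X: "X \<subseteq> M" "card X = min CARD('d) (card M)" "finite X"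
      by (rule obtain_subset_with_card_n[of "min CARD('d) (card M)" M]) auto
    have "vec_indep X (\<lambda>x. p x - p v)"
      by (rule generic_vec_indep[OF gen]) (use X S v in \<open>auto simp: M_def\<close>)
    then have "edge_indep p (B \<union> (\<lambda>x. {v, x}) ` X)"
      using X v Bv by (intro edge_indep_add_vertex finB B(2)) (auto simp: M_def)
    from card_le_edge_rank[OF finS(2) star(1)[OF X(1)] this] show ?thesis
      using star(2)[OF X(1)] X(2) B(3) unfolding rank_gain_def if_not_P[OF False] by simp
  next
    case True
    have "\<exists>e\<in>vertex_pairs M. edge_row p e \<notin> edge_span p {e \<in> J. v \<notin> e}"
      using nbr_closedD[OF v(1), of M] True by (auto simp: M_def)
    then obtain x y where xy: "x \<in> M" "y \<in> M" "x \<noteq> y"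
      and nspan: "edge_row p {x, y} \<notin> edge_span p {e \<in> J. v \<notin> e}"
      by (auto simp: vertex_pairs_iff)
    have "B \<subseteq> {e \<in> J. v \<notin> e}" using B(1) Bv by (auto simp: induced_def)
    then have nspanB: "edge_row p {x, y} \<notin> edge_span p B" using nspan edge_span_mono by blast
    then have xyB: "{x, y} \<notin> B" using edge_span_base by blast
    have ind: "edge_indep p (insert {x, y} B)"
      using edge_indep_insert[OF finB B(2) xyB] nspanB by simp
    have "\<exists>X. {x, y} \<subseteq> X \<and> X \<subseteq> M \<and> card X = CARD('d) + 1"
      using True xy finM by (intro exists_subset_between) (auto simp: Suc_le_eq)
    then obtain X where X: "{x, y} \<subseteq> X" "X \<subseteq> M" "card X = CARD('d) + 1" by blast
    have "edge_indep p (B \<union> (\<lambda>x. {v, x}) ` X)"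
    proof (rule edge_indep_one_extension[OF gen finB Bv(2) _ _ X(3) _ _ xy(3) v(1) xyB ind])
      show "X \<subseteq> V - {v}" using X(2) S v by (auto simp: M_def)
    qed (use X finite_subset[OF X(2) finM] in auto)
    from card_le_edge_rank[OF finS(2) star(1)[OF X(2)] this] show ?thesis
      using star(2)[OF X(2)] X(3) B(3) True unfolding rank_gain_def if_P[OF True] by simp
  qed
qed

text \<open>Only the pair \<open>{x, y}\<close> lies in neither subclique. The d or more remaining
  vertices of \<open>M\<close> put it into the span by \<open>glue_vertex\<close>, and closedness at
  \<open>v\<close> then adds it to \<open>J\<close>.\<close>

lemma clique_if_two_subcliques:
  assumes v: "v \<in> V" and M: "M \<subseteq> neighbours J v" "CARD('d) + 2 \<le> card M"
    and xy: "x \<in> M" "y \<in> M" "x \<noteq> y" "clique J (M - {x})" "clique J (M - {y})"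
  shows "clique J M"
proof (rule nbr_closedD[OF v M(1)])
  show "CARD('d) + 1 \<le> card M" using M(2) by simp
  have MV: "M \<subseteq> V - {v}" using M(1) neighbours_subset[OF J] by blast
  have finM: "finite M" using finite_subset[OF MV] V by simp
  let ?F = "{e \<in> J. v \<notin> e}"
  have FM: "vertex_pairs (M - {x}) \<subseteq> ?F" "vertex_pairs (M - {y}) \<subseteq> ?F"
    using xy MV by (auto simp: vertex_pairs_def)
  fix e assume e: "e \<in> vertex_pairs M"
  show "edge_row p e \<in> edge_span p ?F"
  proof (cases "e = {x, y}")
    case True
    have "CARD('d) \<le> card (M - {x, y})" using M(2) xy finM by (simp add: card_Diff_subset)
    then obtain U where U: "U \<subseteq> M - {x, y}" "card U = CARD('d)" "finite U"
      by (rule obtain_subset_with_card_n)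
    have "edge_row p {x, y} \<in> edge_span p ?F"
    proof (rule glue_vertex[OF gen _ U(3,2)])
      show "vertex_pairs (insert y U) \<subseteq> ?F"
        using FM(1) vertex_pairs_mono[of "insert y U" "M - {x}"] U(1) xy by auto
      show "{x, u} \<in> ?F" if "u \<in> U" for u
      proof -
        have "{x, u} \<in> vertex_pairs (M - {y})" using that U(1) xy by (auto simp: doubleton_in_vertex_pairs)
        then show ?thesis using FM(2) by blast
      qed
    qed (use U MV xy in auto)
    then show ?thesis using True by simp
  next
    case False
    obtain a b where "a \<in> M" "b \<in> M" "a \<noteq> b" "e = {a, b}" using e by (auto simp: vertex_pairs_iff)
    then have "e \<in> vertex_pairs (M - {x}) \<or> e \<in> vertex_pairs (M - {y})"
      using False xy(3) by (auto simp: doubleton_in_vertex_pairs)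
    then show ?thesis using FM by (intro edge_span_base) blast
  qed
qed

text \<open>The random order appears as induction on \<open>S\<close>: for each last vertex
  \<open>v\<close>, the weights for \<open>S - {v}\<close> plus the gain at \<open>v\<close> bound
  the rank from below. Summing over \<open>v\<close> and regrouping by the other vertex reduces the
  claim to \<open>vertex_weight_recursion\<close>.\<close>

lemma edge_rank_ge_sum_weights:
  assumes "S \<subseteq> V"
  shows "(\<Sum>v\<in>S. vertex_weight CARD('d) (clique J (neighbours J v \<inter> S)) (card (neighbours J v \<inter> S)))
    \<le> edge_rank p (induced J S)"
  using assms
proof (induction "card S" arbitrary: S)
  case 0
  then have "S = {}" using finite_subset[OF 0(2) V] by simp
  then show ?case by simp
next
  case (Suc n)
  define d where "d = CARD('d)"
  define wt where "wt A = vertex_weight d (clique J A) (card A)" for A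
  have d1: "1 \<le> d" by (simp add: d_def Suc_le_eq)
  have finS: "finite S" by (rule finite_subset[OF Suc.prems V])
  define N where "N v = neighbours J v \<inter> S" for v
  define g where "g v = rank_gain d (clique J (N v)) (card (N v))" for v
  have N: "finite (N v)" "N v \<subseteq> S - {v}" for v
    using finS neighbours_subset[OF J, of v] by (auto simp: N_def)
  have step: "(\<Sum>u\<in>S - {v}. wt (N u - {v})) + g v \<le> edge_rank p (induced J S)" if v: "v \<in> S" for v
  proof -
    have "card (S - {v}) = n" using Suc.hyps(2) v finS by simp
    then have "(\<Sum>u\<in>S - {v}. wt (neighbours J u \<inter> (S - {v}))) \<le> edge_rank p (induced J (S - {v}))"
      using Suc.hyps(1)[of "S - {v}"] Suc.prems unfolding wt_def d_def by auto
    moreover have "neighbours J u \<inter> (S - {v}) = N u - {v}" for u by (auto simp: N_def)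
    moreover have "edge_rank p (induced J (S - {v})) + g v \<le> edge_rank p (induced J S)"
    proof -
      have "neighbours J v \<inter> (S - {v}) = N v" using N(2)[of v] by (auto simp: N_def)
      moreover have "insert v (S - {v}) = S" using v by blast
      ultimately show ?thesis
        using rank_gain_step[of "S - {v}" v] Suc.prems v unfolding g_def d_def by auto
    qed
    ultimately show ?thesis by simp
  qed
  have rec: "(\<Sum>v\<in>S - {u}. wt (N u - {v})) + g u \<ge> card S * wt (N u)" if u: "u \<in> S" for u
  proof -
    \<comment> \<open>Removing a vertex outside \<open>N u\<close> leaves the neighbourhood of
      \<open>u\<close> unchanged; only \<open>v\<close> in \<open>N u\<close> enters the
      recursion.\<close>
    have "(\<Sum>v\<in>S - {u}. wt (N u - {v})) = (\<Sum>v\<in>N u. wt (N u - {v})) + (\<Sum>v\<in>S - {u} - N u. wt (N u - {v}))"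
      using sum.subset_diff[OF N(2)[of u], of "\<lambda>v. wt (N u - {v})"] finS by simp
    also have "(\<Sum>v\<in>S - {u} - N u. wt (N u - {v})) = card (S - {u} - N u) * wt (N u)"
      by simp
    also have "real (card (S - {u} - N u)) = real (card S) - 1 - card (N u)"
    proof -
      have "card (S - {u} - N u) = card S - 1 - card (N u)"
        using N[of u] u finS by (simp add: card_Diff_subset)
      moreover have "card (N u) \<le> card S - 1" using card_mono[OF _ N(2)[of u]] finS u by simp
      moreover have "card S \<ge> 1" using u finS by (simp add: Suc_le_eq card_gt_0_iff) blast
      ultimately show ?thesis by linarith
    qed
    finally have eq: "(\<Sum>v\<in>S - {u}. wt (N u - {v})) =
      (\<Sum>v\<in>N u. wt (N u - {v})) + (real (card S) - 1 - card (N u)) * wt (N u)" .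
    have "(card (N u) + 1) * wt (N u) \<le> g u + (\<Sum>v\<in>N u. vertex_weight d (clique J (N u - {v})) (card (N u) - 1))"
      unfolding wt_def g_def
    proof (rule vertex_weight_recursion[OF d1 N(1)])
      show "clique J (N u - {x})" if "clique J (N u)" for x
        using that vertex_pairs_mono[of "N u - {x}" "N u"] by blast
      show "clique J (N u)" if "d + 2 \<le> card (N u)" "x \<in> N u" "y \<in> N u" "x \<noteq> y"
        "clique J (N u - {x})" "clique J (N u - {y})" for x y
        using clique_if_two_subcliques[of u "N u" x y] that u Suc.prems by (auto simp: N_def d_def)
    qed
    moreover have "(\<Sum>v\<in>N u. vertex_weight d (clique J (N u - {v})) (card (N u) - 1)) = (\<Sum>v\<in>N u. wt (N u - {v}))"
      using N(1) by (intro sum.cong refl) (simp add: wt_def)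
    ultimately show ?thesis unfolding eq by (simp add: algebra_simps)
  qed
  have "card S * (\<Sum>u\<in>S. wt (N u)) \<le> (\<Sum>u\<in>S. (\<Sum>v\<in>S - {u}. wt (N u - {v})) + g u)"
    unfolding sum_distrib_left by (rule sum_mono) (rule rec)
  also have "\<dots> = (\<Sum>v\<in>S. (\<Sum>u\<in>S - {v}. wt (N u - {v})) + g v)"
  proof -
    have "(\<Sum>u\<in>S. \<Sum>v\<in>S - {u}. wt (N u - {v})) = (\<Sum>u\<in>S. \<Sum>v\<in>{v \<in> S. v \<noteq> u}. wt (N u - {v}))"
      by (intro sum.cong refl) auto
    also have "\<dots> = (\<Sum>v\<in>S. \<Sum>u\<in>{u \<in> S. v \<noteq> u}. wt (N u - {v}))"
      by (rule sum.swap_restrict[OF finS finS])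
    also have "\<dots> = (\<Sum>v\<in>S. \<Sum>u\<in>S - {v}. wt (N u - {v}))"
      by (intro sum.cong refl) auto
    finally show ?thesis by (simp add: sum.distrib)
  qed
  also have "\<dots> \<le> (\<Sum>v\<in>S. real (edge_rank p (induced J S)))"
    by (rule sum_mono) (rule step)
  finally have "real (card S) * (\<Sum>u\<in>S. wt (N u)) \<le> card S * edge_rank p (induced J S)" by simp
  moreover have "real (card S) > 0" using Suc.hyps(2) by simp
  ultimately have "(\<Sum>u\<in>S. wt (N u)) \<le> edge_rank p (induced J S)" by simp
  then show ?case by (simp add: wt_def N_def d_def)
qed

text \<open>The closure rule is applied at a neighbour \<open>w\<close> of \<open>v\<close>, not at
  \<open>v\<close>: every other vertex is a neighbour of \<open>w\<close>, and gluing
  \<open>v\<close> along d further neighbours puts all pairs of \<open>V - {w}\<close> into the span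
  without using \<open>w\<close>.\<close>

lemma complete_if_complete_minus_vertex:
  assumes v: "v \<in> V" and compl: "clique J (V - {v})" and deg: "CARD('d) + 1 \<le> card (neighbours J v)"
  shows "clique J V"
proof -
  let ?N = "neighbours J v"
  have NV: "?N \<subseteq> V - {v}" by (rule neighbours_subset[OF J])
  have finN: "finite ?N" using finite_subset[OF NV] V by simp
  obtain w where w: "w \<in> ?N" using deg by fastforce
  then have wV: "w \<in> V" "w \<noteq> v" using NV by auto
  let ?W = "V - {w}" let ?F = "{e \<in> J. w \<notin> e}"
  have "CARD('d) \<le> card (?N - {w})" using deg w finN by simp
  then obtain U where U: "U \<subseteq> ?N - {w}" "card U = CARD('d)" "finite U"
    by (rule obtain_subset_with_card_n)
  have WJ: "clique J ?W"
  proof (rule nbr_closedD[OF wV(1)])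
    show "?W \<subseteq> neighbours J w"
    proof
      fix x assume x: "x \<in> ?W"
      show "x \<in> neighbours J w"
      proof (cases "x = v")
        case True
        then show ?thesis using w by (simp add: neighbours_def insert_commute)
      next
        case False
        then have "{w, x} \<in> vertex_pairs (V - {v})" using x wV by (auto simp: doubleton_in_vertex_pairs)
        then show ?thesis using compl by (auto simp: neighbours_def)
      qed
    qed
    have "card ?N \<le> card (V - {v})" by (rule card_mono[OF _ NV]) (use V in simp)
    then show "CARD('d) + 1 \<le> card ?W" using deg V v wV by simp
  next
    fix e assume e: "e \<in> vertex_pairs ?W"
    show "edge_row p e \<in> edge_span p ?F"
    proof (cases "v \<in> e")
      case False
      then have "e \<in> ?F" using e compl by (auto simp: vertex_pairs_def subset_iff)
      then show ?thesis by (rule edge_span_base)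
    next
      case True
      then obtain y where y: "e = {v, y}" "y \<in> ?W" "y \<noteq> v"
        using e by (auto simp: vertex_pairs_iff doubleton_eq_iff)
      have vu: "{v, u} \<in> ?F" if "u \<in> U" for u
        using that U(1) wV by (auto simp: neighbours_def)
      show ?thesis
      proof (cases "y \<in> U")
        case True
        then show ?thesis using vu y(1) by (simp add: edge_span_base)
      next
        case False
        show ?thesis
          unfolding y(1)
        proof (rule glue_vertex[OF gen _ U(3,2)])
          show "vertex_pairs (insert y U) \<subseteq> ?F"
            using compl y U(1) NV by (auto simp: vertex_pairs_def subset_iff)
        qed (use U NV y v vu False in auto)
      qed
    qed
  qed
  show ?thesis
  proof
    fix e assume e: "e \<in> vertex_pairs V"
    show "e \<in> J"
    proof (cases "w \<in> e \<and> v \<in> e")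
      case True
      then have "e = {v, w}" using e wV by (auto simp: vertex_pairs_iff)
      then show ?thesis using w by (simp add: neighbours_def)
    next
      case False
      then have "e \<in> vertex_pairs ?W \<or> e \<in> vertex_pairs (V - {v})" using e by (auto simp: vertex_pairs_def)
      then show ?thesis using WJ compl by blast
    qed
  qed
qed

end

text \<open>Connectivity is assumed of \<open>J \<union> E0\<close>, since \<open>J\<close> alone
  may have lost it. Discarding a simplicial vertex preserves either alternative: restoring it adds
  at least d to the rank, or turns a complete graph into a complete one.\<close>

lemma closed_dichotomy:
  fixes p :: "'a \<Rightarrow> real ^ 'd"
  defines "d \<equiv> CARD('d)"
  assumes "finite V" "generic_placement V p" "J \<subseteq> vertex_pairs V" "E0 \<subseteq> vertex_pairs V"
    and small: "2 * card E0 \<le> d * (d + 1)"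
    and "k_connected (d * (d + 1)) V (J \<union> E0)" "nbr_closed p V J"
  shows "clique J V \<or> d * card V \<le> edge_rank p J + card E0"
  using assms(2-5,7-)
proof (induction "card V" arbitrary: V J rule: less_induct)
  case less
  note V = less.prems(1) and gen = less.prems(2) and J = less.prems(3) and E0 = less.prems(4)
    and con = less.prems(5) and closed = less.prems(6)
  have d1: "1 \<le> d" by (simp add: d_def Suc_le_eq)
  have finE0: "finite E0" by (rule finite_subset[OF E0 finite_vertex_pairs[OF V]])
  have finN: "finite (neighbours J v)" "finite (neighbours E0 v)" for v
    using neighbours_subset[OF J, of v] neighbours_subset[OF E0, of v] V by (auto intro: finite_subset)
  define e where "e v = card {f \<in> E0. v \<in> f}" for v
  have nbE0: "card (neighbours E0 v) \<le> e v" for v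
    unfolding e_def
    by (rule card_inj_on_le[of "\<lambda>w. {v, w}"]) (use finE0 in \<open>auto simp: inj_on_def doubleton_eq_iff neighbours_def\<close>)
  have deg: "d * (d + 1) \<le> card (neighbours J v) + e v" if "v \<in> V" for v
  proof -
    have "d * (d + 1) \<le> card (neighbours (J \<union> E0) v)"
      by (rule k_connected_degree[OF V _ con that]) (use J E0 in blast)
    also have "neighbours (J \<union> E0) v = neighbours J v \<union> neighbours E0 v" by (auto simp: neighbours_def)
    also have "card \<dots> \<le> card (neighbours J v) + card (neighbours E0 v)" by (rule card_Un_le)
    finally show ?thesis using nbE0[of v] by linarith
  qed
  have indV: "induced J V = J" using J by (auto simp: induced_def vertex_pairs_def)
  have cardV: "card V > d * (d + 1)" using con by (simp add: k_connected_def)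
  show ?case
  proof (cases "\<exists>v\<in>V. clique J (neighbours J v) \<and> e v = 0")
    case True
    then obtain v where v: "v \<in> V" "clique J (neighbours J v)" "e v = 0" by blast
    let ?V = "V - {v}" let ?J = "{f \<in> J. v \<notin> f}"
    have noE0: "v \<notin> f" if "f \<in> E0" for f
      using v(3) finE0 that by (auto simp: e_def)
    have degv: "d * (d + 1) \<le> card (neighbours J v)" using deg[OF v(1)] v(3) by simp
    have NV: "neighbours J v \<subseteq> ?V" by (rule neighbours_subset[OF J])
    have dd: "d + 1 \<le> d * (d + 1)" using d1 by simp
    have main: "clique J V \<or> d * card V \<le> edge_rank p J + card E0" if big: "card V > d * (d + 1) + 1"
    proof -
      have "k_connected (d * (d + 1)) ?V {f \<in> J \<union> E0. v \<notin> f}"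
      proof (rule k_connected_remove_simplicial[OF V _ con v(1) _ big])
        have "neighbours (J \<union> E0) v = neighbours J v" using noE0 by (auto simp: neighbours_def)
        then show "vertex_pairs (neighbours (J \<union> E0) v) \<subseteq> J \<union> E0" using v(2) by auto
      qed (use J E0 in blast)
      moreover have "{f \<in> J \<union> E0. v \<notin> f} = ?J \<union> E0" using noE0 by auto
      ultimately have con': "k_connected (d * (d + 1)) ?V (?J \<union> E0)" by simp
      have closed': "nbr_closed p ?V ?J"
        unfolding nbr_closed_def
      proof (intro ballI allI impI)
        fix u W assume u: "u \<in> ?V" and W: "W \<subseteq> neighbours ?J u" "CARD('d) + 1 \<le> card W"
          and span: "\<forall>f\<in>vertex_pairs W. edge_row p f \<in> edge_span p {f \<in> ?J. u \<notin> f}"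
        have "clique J W"
        proof (rule nbr_closedD[OF gen V J closed, of u W])
          show "W \<subseteq> neighbours J u" using W by (auto simp: neighbours_def)
          show "edge_row p f \<in> edge_span p {f \<in> J. u \<notin> f}" if "f \<in> vertex_pairs W" for f
            using span that edge_span_mono[of "{f \<in> ?J. u \<notin> f}" "{f \<in> J. u \<notin> f}" p] by blast
        qed (use u W in auto)
        moreover have "v \<notin> W" using W by (auto simp: neighbours_def)
        ultimately show "vertex_pairs W \<subseteq> ?J" by (auto simp: vertex_pairs_def)
      qed
      have J': "?J \<subseteq> vertex_pairs ?V" using J by (auto simp: vertex_pairs_def)
      have E0': "E0 \<subseteq> vertex_pairs ?V" using E0 noE0 by (auto simp: vertex_pairs_def)
      have "card ?V < card V" by (rule card_Diff1_less[OF V v(1)])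
      from less.hyps[OF this _ generic_placement_mono[OF gen] J' E0' con' closed'] V
      consider "clique ?J ?V" | "d * card ?V \<le> edge_rank p ?J + card E0" by auto
      then show ?thesis
      proof cases
        case 1
        have "clique J V"
          by (rule complete_if_complete_minus_vertex[OF gen V J closed v(1)])
            (use 1 order_trans[OF dd degv] in \<open>auto simp: d_def\<close>)
        then show ?thesis by simp
      next
        case 2
        have "induced J ?V = ?J" using J by (auto simp: induced_def vertex_pairs_def)
        moreover have "neighbours J v \<inter> ?V = neighbours J v" using NV by blast
        moreover have "insert v ?V = V" using v(1) by blast
        ultimately have "edge_rank p ?J + rank_gain d (clique J (neighbours J v)) (card (neighbours J v)) \<le> edge_rank p J"
          using rank_gain_step[OF gen V J closed, of ?V v] v(1) indV by (simp add: d_def)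
        moreover have "d \<le> rank_gain d (clique J (neighbours J v)) (card (neighbours J v))"
          using degv dd by (simp add: rank_gain_def)
        moreover have "d * card V = d * card ?V + d"
          using V v(1) card_Suc_Diff1[OF V v(1)] by (metis mult_Suc_right add.commute)
        ultimately show ?thesis using 2 by linarith
      qed
    qed
    show ?thesis
    proof (cases "card V > d * (d + 1) + 1")
      case False
      \<comment> \<open>With only d(d+1) + 1 vertices too few would remain for the induction. But
        then \<open>v\<close> is adjacent to all others, and its neighbourhood is a clique.\<close>
      then have "card ?V \<le> card (neighbours J v)" using degv V v(1) by simp
      then have N: "neighbours J v = ?V" using NV V by (intro card_seteq) auto
      have "clique J V"
      proof
        fix f assume f: "f \<in> vertex_pairs V"
        show "f \<in> J"
        proof (cases "v \<in> f")
          case True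
          then obtain y where "f = {v, y}" "y \<in> ?V" using f by (auto simp: vertex_pairs_iff doubleton_eq_iff)
          then show ?thesis using N by (auto simp: neighbours_def)
        next
          case False
          then have "f \<in> vertex_pairs ?V" using f by (auto simp: vertex_pairs_def)
          then show ?thesis using v(2) N by auto
        qed
      qed
      then show ?thesis by simp
    qed (rule main)
  next
    case False
    have e_le: "2 * e v \<le> d * (d + 1)" for v
    proof -
      have "e v \<le> card E0" unfolding e_def by (rule card_mono[OF finE0]) auto
      then show ?thesis using small by linarith
    qed
    have "real d - e v / 2 \<le> vertex_weight d (clique J (neighbours J v \<inter> V)) (card (neighbours J v \<inter> V))"
      if v: "v \<in> V" for v
    proof (rule vertex_weight_lower_bound[OF d1 e_le])
      have N: "neighbours J v \<inter> V = neighbours J v" using neighbours_subset[OF J, of v] by blast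
      show "d * (d + 1) \<le> card (neighbours J v \<inter> V) + e v" using deg[OF v] N by simp
      show "1 \<le> e v" if "clique J (neighbours J v \<inter> V)" using False v that N by (auto simp: Suc_le_eq)
    qed
    then have "(\<Sum>v\<in>V. real d - e v / 2) \<le> (\<Sum>v\<in>V. vertex_weight d (clique J (neighbours J v \<inter> V)) (card (neighbours J v \<inter> V)))"
      by (rule sum_mono)
    also have "\<dots> \<le> edge_rank p J"
      using edge_rank_ge_sum_weights[OF gen V J closed order_refl] indV by (simp add: d_def)
    finally have sum: "(\<Sum>v\<in>V. real d - e v / 2) \<le> edge_rank p J" .
    \<comment> \<open>Each deleted edge is counted at both ends, so the losses e/2 add up to
      \<open>card E0\<close>.\<close>
    have "(\<Sum>v\<in>V. e v) = (\<Sum>v\<in>V. \<Sum>f\<in>{f \<in> E0. v \<in> f}. 1)" by (simp add: e_def)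
    also have "\<dots> = (\<Sum>f\<in>E0. \<Sum>v\<in>{v \<in> V. v \<in> f}. 1)" by (rule sum.swap_restrict[OF V finE0])
    also have "\<dots> = (\<Sum>f\<in>E0. 2)"
    proof (rule sum.cong[OF refl])
      fix f assume "f \<in> E0"
      then have "f \<subseteq> V" "card f = 2" using E0 by (auto simp: vertex_pairs_def)
      moreover from this have "{v \<in> V. v \<in> f} = f" by blast
      ultimately show "(\<Sum>v\<in>{v \<in> V. v \<in> f}. 1) = (2::nat)" by simp
    qed
    finally have "(\<Sum>v\<in>V. e v) = 2 * card E0" by simp
    then have "(\<Sum>v\<in>V. real (e v)) = 2 * real (card E0)" by (metis of_nat_sum of_nat_mult of_nat_numeral)
    then have "(\<Sum>v\<in>V. real d - e v / 2) = real d * card V - card E0"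
      by (simp add: sum_subtractf sum_divide_distrib[symmetric])
    then have "real (d * card V) \<le> real (edge_rank p J + card E0)" using sum by simp
    then have "d * card V \<le> edge_rank p J + card E0" by (simp only: of_nat_le_iff)
    then show ?thesis ..
  qed
qed

section \<open>Redundant rigidity and redundant global rigidity at a generic placement\<close>

lemma choose_two_double: "2 * ((n + 1) choose 2) = n * (n + 1)"
  by (simp add: choose_two)

context
  fixes V :: "'a set" and E E0 :: "'a set set" and p :: "'a \<Rightarrow> real ^ 'd"
  assumes graph: "simple_graph V E" and con: "k_connected (CARD('d) * (CARD('d) + 1)) V E"
    and E0: "E0 \<subseteq> E" and gen: "generic_placement V p"
begin

lemma finite_V: "finite V" and E_pairs: "E \<subseteq> vertex_pairs V"
  using graph by (auto simp: simple_graph_def vertex_pairs_def)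

lemma edge_rank_vertex_pairs_le:
  "2 * edge_rank p (vertex_pairs V) + CARD('d) * (CARD('d) + 1) \<le> 2 * CARD('d) * card V"
proof (rule edge_rank_complete_le[OF gen finite_V order_refl])
  have "CARD('d) \<le> CARD('d) * (CARD('d) + 1)" by simp
  then show "CARD('d) \<le> card V" using con by (simp add: k_connected_def)
qed

lemma closed_superset_dichotomy:
  assumes "2 * card E0 \<le> CARD('d) * (CARD('d) + 1)" "E - E0 \<subseteq> J" "J \<subseteq> vertex_pairs V" "nbr_closed p V J"
  shows "clique J V \<or> CARD('d) * card V \<le> edge_rank p J + card E0"
proof (rule closed_dichotomy[OF finite_V gen assms(3) _ assms(1) _ assms(4)])
  show "E0 \<subseteq> vertex_pairs V" using E0 E_pairs by blast
  show "k_connected (CARD('d) * (CARD('d) + 1)) V (J \<union> E0)"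
    by (rule k_connected_mono[OF con]) (use assms(2) in blast)
qed

lemma rigid_framework_minus_edges:
  assumes small: "2 * card E0 \<le> CARD('d) * (CARD('d) + 1)"
  shows "rigid_framework V (E - E0) p"
proof (rule rigid_framework_if_spanning[OF gen finite_V])
  show "E - E0 \<subseteq> vertex_pairs V" using E_pairs by blast
  define J where "J = {e \<in> vertex_pairs V. edge_row p e \<in> edge_span p (E - E0)}"
  have JV: "J \<subseteq> vertex_pairs V" by (auto simp: J_def)
  have span: "f \<in> edge_span p (E - E0)" if "f \<in> edge_span p F" "F \<subseteq> J" for f F
    using that(1) by (rule edge_span_trans) (use that(2) in \<open>auto simp: J_def\<close>)
  have "nbr_closed p V J"
    unfolding nbr_closed_def
  proof (intro ballI allI impI)
    fix v W assume W: "W \<subseteq> neighbours J v"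
      and linked: "\<forall>e\<in>vertex_pairs W. edge_row p e \<in> edge_span p {e \<in> J. v \<notin> e}"
    have "W \<subseteq> V" using W neighbours_subset[OF JV, of v] by blast
    then show "vertex_pairs W \<subseteq> J"
      using linked span[of _ "{e \<in> J. v \<notin> e}"] vertex_pairs_mono[of W V] unfolding J_def by blast
  qed
  moreover have "E - E0 \<subseteq> J" using E_pairs by (auto simp: J_def intro: edge_span_base)
  ultimately have dich: "clique J V \<or> CARD('d) * card V \<le> edge_rank p J + card E0"
    using closed_superset_dichotomy[OF small _ JV] by blast
  fix e assume e: "e \<in> vertex_pairs V"
  show "edge_row p e \<in> edge_span p (E - E0)"
  proof (cases "clique J V")
    case True
    then show ?thesis using e by (auto simp: J_def)
  next
    case False
    \<comment> \<open>The lower bound for \<open>J\<close> reaches the upper bound for the complete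
      graph, also when \<open>2 * card E0 = d * (d + 1)\<close>; equal rank makes \<open>J\<close>
      span all pairs.\<close>
    then have "edge_rank p (vertex_pairs V) \<le> edge_rank p J"
      using dich edge_rank_vertex_pairs_le small by auto
    then have "edge_row p e \<in> edge_span p J"
      by (rule edge_rank_eq_imp_span[OF finite_vertex_pairs[OF finite_V] JV _ e])
    then show ?thesis by (rule span) simp
  qed
qed

text \<open>\<open>J\<close>, the pairs whose length is forced for this \<open>p\<close>, need not
  be closed in the matroid, so full rank would not make it complete. The strict bound on
  \<open>card E0\<close> rules out the rank alternative altogether.\<close>

lemma globally_rigid_framework_minus_edges:
  assumes small: "2 * card E0 < CARD('d) * (CARD('d) + 1)"
  shows "globally_rigid_framework V (E - E0) p"
proof -
  define J where "J = {e \<in> vertex_pairs V. \<forall>q. same_edge_lengths (E - E0) p q \<longrightarrow>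
    (\<forall>x y. e = {x, y} \<longrightarrow> dist (p x) (p y) = dist (q x) (q y))}"
  have JV: "J \<subseteq> vertex_pairs V" by (auto simp: J_def)
  have "nbr_closed p V J"
    unfolding nbr_closed_def
  proof (intro ballI allI impI subsetI)
    fix v W e assume v: "v \<in> V" and W: "W \<subseteq> neighbours J v" "CARD('d) + 1 \<le> card W"
      and linked: "\<forall>e\<in>vertex_pairs W. edge_row p e \<in> edge_span p {e \<in> J. v \<notin> e}"
      and e: "e \<in> vertex_pairs W"
    have WV: "W \<subseteq> V - {v}" using W(1) neighbours_subset[OF JV, of v] by blast
    have finW: "finite W" using finite_subset[OF WV] finite_V by simp
    have "dist (p x) (p y) = dist (q x) (q y)"
      if q: "same_edge_lengths (E - E0) p q" and xy: "e = {x, y}" for q x y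
    proof -
      have xyW: "x \<in> W" "y \<in> W" "x \<noteq> y" using e xy by (auto simp: doubleton_in_vertex_pairs)
      \<comment> \<open>\<open>neighbourhood_congruent\<close> takes exactly d + 1 neighbours, so
        \<open>W\<close> is cut down around the pair in question.\<close>
      have "\<exists>W'. {x, y} \<subseteq> W' \<and> W' \<subseteq> W \<and> card W' = CARD('d) + 1"
        using W(2) xyW finW by (intro exists_subset_between) (auto simp: Suc_le_eq)
      then obtain W' where W': "{x, y} \<subseteq> W'" "W' \<subseteq> W" "card W' = CARD('d) + 1" by blast
      show ?thesis
      proof (rule neighbourhood_congruent[OF gen finite_V JV _ v _ _ W'(3)])
        show "dist (p a) (p b) = dist (q a) (q b)" if "{a, b} \<in> J" for a b
          using that q unfolding J_def by blast
        show "edge_row p f \<in> edge_span p {e \<in> J. v \<notin> e}" if "f \<in> vertex_pairs W'" for f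
          using linked that vertex_pairs_mono[OF W'(2)] by blast
      qed (use W' WV W(1) in \<open>auto simp: neighbours_def\<close>)
    qed
    moreover have "e \<in> vertex_pairs V" using e vertex_pairs_mono[of W V] WV by blast
    ultimately show "e \<in> J" by (auto simp: J_def)
  qed
  moreover have "E - E0 \<subseteq> J"
    using E_pairs by (auto simp: J_def same_edge_lengths_def)
  ultimately have dich: "clique J V \<or> CARD('d) * card V \<le> edge_rank p J + card E0"
    using closed_superset_dichotomy[OF less_imp_le[OF small] _ JV] by blast
  have "edge_rank p J \<le> edge_rank p (vertex_pairs V)"
    by (rule edge_rank_mono[OF finite_vertex_pairs[OF finite_V] JV])
  then have compl: "clique J V" using dich edge_rank_vertex_pairs_le small by auto
  have "dist (p u) (p v) = dist (q u) (q v)"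
    if "same_edge_lengths (E - E0) p q" "u \<in> V" "v \<in> V" for q u v
  proof (cases "u = v")
    case False
    then have "{u, v} \<in> J" using compl that by (auto simp: doubleton_in_vertex_pairs subset_iff)
    then show ?thesis using that(1) unfolding J_def by blast
  qed simp
  then show ?thesis unfolding globally_rigid_framework_def same_distances_def by blast
qed

end

theorem theorem5p1:
  fixes V :: "'a set" and E :: "'a set set"
  assumes "simple_graph V E"
    and "k_connected (CARD('d::finite) * (CARD('d) + 1)) V E"
  shows "redundantly_rigid TYPE('d) (((CARD('d) + 1) choose 2) + 1) V E \<and>
         redundantly_globally_rigid TYPE('d) ((CARD('d) + 1) choose 2) V E"
proof -
  have "finite V" using assms(1) by (simp add: simple_graph_def)
  then obtain p :: "'a \<Rightarrow> real ^ 'd" where gen: "generic_placement V p"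
    using generic_placement_exists by blast
  note choose = choose_two_double[of "CARD('d)"]
  show ?thesis
    unfolding redundantly_rigid_def redundantly_globally_rigid_def rigid_graph_def globally_rigid_graph_def
  proof (intro conjI allI impI)
    fix E0 assume E0: "E0 \<subseteq> E" "card E0 < ((CARD('d) + 1) choose 2) + 1"
    then have "2 * card E0 \<le> CARD('d) * (CARD('d) + 1)" using choose by linarith
    from rigid_framework_minus_edges[OF assms E0(1) gen this]
    show "\<exists>p :: 'a \<Rightarrow> real ^ 'd. generic_placement V p \<and> rigid_framework V (E - E0) p" using gen by blast
  next
    fix E0 assume E0: "E0 \<subseteq> E" "card E0 < ((CARD('d) + 1) choose 2)"
    then have "2 * card E0 < CARD('d) * (CARD('d) + 1)" using choose by linarith
    from globally_rigid_framework_minus_edges[OF assms E0(1) gen this]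
    show "\<exists>p :: 'a \<Rightarrow> real ^ 'd. generic_placement V p \<and> globally_rigid_framework V (E - E0) p" using gen by blast
  qed
qed

end
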